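(* Fix a spin $s\in\{\tfrac12,1,\tfrac32,\dots\}$, exponents $\tfrac12<b<a\le1$, and a constant $c>0$ with $$c<\frac{a-b}{4\log_2(2s+1)}.$$ For each $N$, let $J=J(N)\sim N^a$ be a total-spin quantum number occurring in the system of $N$ spin-$s$ qudits, let $M=M(N)>0$ be a magnetic quantum number with $M\sim N^b$, and let $d=d(N)=(c+o(1))\log_2N$. Consider the probe state $|\psi_0\rangle=\tfrac{1}{\sqrt2}(|J,M\rangle+|J,-M\rangle)$, $|\psi_\theta\rangle=e^{-i\theta\hat Q^z}|\psi_0\rangle$, $\psi_\theta=|\psi_\theta\rangle\langle\psi_\theta|$. Then for every ($\theta$-independent) noise channel $\mathcal N(\rho)=\sum_{j}K_j\rho K_j^\dagger$ whose Kraus operators all act nontrivially only on one fixed (known) set of $d$ qudits, the quantum Fisher information of the noisy probe state satisfies $$\mathfrak F\big(\mathcal N(\psi_\theta);\,\mathcal N(\partial_\theta\psi_\theta)\big)=\Theta(N^{2b})\qquad(N\to\infty),$$ so that it scales superlinearly in $N$.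
   Context: System: $N$ spin-$s$ degrees of freedom (qudits of dimension $2s+1$) with local spin operators $\hat q_j^z,\hat q_j^\pm$ satisfying $[\hat q_j^+,\hat q_j^-]=2\hat q_j^z$, $[\hat q_j^z,\hat q_j^\pm]=\pm\hat q_j^\pm$ (spin-$s$ irreducible representation on each site), and total operators $\hat Q^z=\sum_j\hat q_j^z$, $\hat Q^\pm=\sum_j\hat q_j^\pm$. For a total spin $J\le sN$, $\{|J,M\rangle\}_{M=-J}^{J}$ denotes any family of orthonormal states satisfying $\hat Q^z|J,M\rangle=M|J,M\rangle$ and $\hat Q^\pm|J,M\rangle=\sqrt{(J\mp M)(J\pm M+1)}\,|J,M\pm1\rangle$ (a spin-$J$ irrep, possibly chosen among or superposed over several copies of it; the same choice for all $M$). The Kraus operators on the $d$ affected qudits can be taken to number at most $(2s+1)^{2d}$. For a family of states $\rho_\theta$, the quantum Fisher information is $\mathfrak F(\rho_\theta;\partial_\theta\rho_\theta)=\mathrm{Tr}(\rho_\theta R^2)$, where $R$ is a Hermitian operator satisfying $\rho_\theta R+R\rho_\theta=2\partial_\theta\rho_\theta$. Here $\partial_\theta\psi_\theta=-i[\hat Q^z,\psi_\theta]$. $X\sim Y$ means $X=\Theta(Y)$ as $N\to\infty$; the constants in $\Theta(N^{2b})$ are uniform over $\theta$ and the noise channel. *)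

theory Defs
  imports
    "HOL-Analysis.Analysis"
    "HOL-Library.FuncSet"
    "HOL-Library.Landau_Symbols"
    "Jordan_Normal_Form.Schur_Decomposition"
    "Jordan_Normal_Form.VS_Connect"
begin

section \<open>Matrices\<close>

definition mat_trace :: "complex mat \<Rightarrow> complex" where
  "mat_trace A = sum_list (diag_mat A)"

definition hermitian :: "complex mat \<Rightarrow> bool" where
  "hermitian A \<longleftrightarrow> mat_adjoint A = A"

text \<open>\<open>mat\<close> is not an instance of \<open>monoid_add\<close> (the zero depends on the dimension), so
  sums of matrices are folded explicitly.\<close>

definition mat_sum :: "nat \<Rightarrow> complex mat list \<Rightarrow> complex mat" where
  "mat_sum n As = foldr (+) As (0\<^sub>m n n)"

definition mat_exp :: "complex mat \<Rightarrow> complex mat" where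
  "mat_exp A = mat (dim_row A) (dim_row A) (\<lambda>(i, j). \<Sum>k. (A ^\<^sub>m k) $$ (i, j) / fact k)"

definition commutator :: "complex mat \<Rightarrow> complex mat \<Rightarrow> complex mat" where
  "commutator A B = A * B - B * A"

definition ket_bra :: "complex vec \<Rightarrow> complex mat" where
  "ket_bra v = mat (dim_vec v) (dim_vec v) (\<lambda>(i, j). v $ i * cnj (v $ j))"

section \<open>Systems of qudits\<close>

text \<open>The space of \<open>N\<close> qudits of dimension \<open>D\<close> is \<open>\<complex>\<close> to the power \<open>D ^ N\<close>. The index
  \<open>x < D ^ N\<close> denotes the product basis vector whose factor at site \<open>j < N\<close> is the
  basis vector numbered by the base-\<open>D\<close> digit \<open>j\<close> of \<open>x\<close>.\<close>

definition site :: "nat \<Rightarrow> nat \<Rightarrow> nat \<Rightarrow> nat" where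
  "site D x j = (x div D ^ j) mod D"

text \<open>The operator \<open>k \<otimes> 1\<close>, where \<open>k\<close> acts on the sites in \<open>A\<close> and the identity on the others.
  The matrix entries of \<open>k\<close> are indexed by the configurations of the sites in \<open>A\<close>.\<close>

definition local_op ::
  "nat \<Rightarrow> nat \<Rightarrow> nat set \<Rightarrow> ((nat \<Rightarrow> nat) \<Rightarrow> (nat \<Rightarrow> nat) \<Rightarrow> complex) \<Rightarrow> complex mat" where
  "local_op N D A k = mat (D ^ N) (D ^ N) (\<lambda>(x, y).
     if \<forall>i \<in> {..<N} - A. site D x i = site D y i
     then k (restrict (site D x) A) (restrict (site D y) A) else 0)"

definition site_op :: "nat \<Rightarrow> nat \<Rightarrow> complex mat \<Rightarrow> nat \<Rightarrow> complex mat" where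
  "site_op N D q j = local_op N D {j} (\<lambda>f g. q $$ (f j, g j))"

definition total_op :: "nat \<Rightarrow> nat \<Rightarrow> complex mat \<Rightarrow> complex mat" where
  "total_op N D q = mat_sum (D ^ N) (map (site_op N D q) [0..<N])"

section \<open>Spin representations\<close>

text \<open>Local spin operators on a single qudit of dimension \<open>D = 2 s + 1\<close>, in an arbitrary
  orthonormal basis. Since the irreducible unitary representation is determined by its
  dimension up to unitary equivalence, no spin label is needed here.\<close>

definition spin_irrep :: "nat \<Rightarrow> complex mat \<Rightarrow> complex mat \<Rightarrow> complex mat \<Rightarrow> bool" where
  "spin_irrep D qz qp qm \<longleftrightarrow>
     qz \<in> carrier_mat D D \<and> qp \<in> carrier_mat D D \<and> qm \<in> carrier_mat D D \<and>
     hermitian qz \<and> qm = mat_adjoint qp \<and>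
     commutator qp qm = 2 \<cdot>\<^sub>m qz \<and>
     commutator qz qp = qp \<and> commutator qz qm = - qm \<and>
     (\<forall>W. VectorSpace.subspace class_ring W (module_vec TYPE(complex) D) \<longrightarrow>
        (\<forall>v\<in>W. qz *\<^sub>v v \<in> W \<and> qp *\<^sub>v v \<in> W \<and> qm *\<^sub>v v \<in> W) \<longrightarrow>
        W = {0\<^sub>v D} \<or> W = carrier_vec D)"

definition magnetic_numbers :: "real \<Rightarrow> real set" where
  "magnetic_numbers J = {m. m \<le> J \<and> (\<exists>k::nat. m = - J + real k)}"

text \<open>\<open>ket m\<close> is the vector \<open>|J, m\<rangle>\<close>. At \<open>m = \<plusminus>J\<close> the ladder coefficient vanishes; the case
  distinction avoids referring to vectors \<open>ket (\<plusminus>(J + 1))\<close>, about which nothing is assumed.\<close>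

definition spin_multiplet ::
  "nat \<Rightarrow> complex mat \<Rightarrow> complex mat \<Rightarrow> complex mat \<Rightarrow> real \<Rightarrow> (real \<Rightarrow> complex vec) \<Rightarrow> bool" where
  "spin_multiplet n Qz Qp Qm J ket \<longleftrightarrow>
     2 * J \<in> \<nat> \<and>
     (\<forall>m\<in>magnetic_numbers J. ket m \<in> carrier_vec n) \<and>
     (\<forall>m\<in>magnetic_numbers J. \<forall>m'\<in>magnetic_numbers J.
        ket m \<bullet>c ket m' = (if m = m' then 1 else 0)) \<and>
     (\<forall>m\<in>magnetic_numbers J.
        Qz *\<^sub>v ket m = complex_of_real m \<cdot>\<^sub>v ket m \<and>
        Qp *\<^sub>v ket m = (if m = J then 0\<^sub>v n
           else complex_of_real (sqrt ((J - m) * (J + m + 1))) \<cdot>\<^sub>v ket (m + 1)) \<and>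
        Qm *\<^sub>v ket m = (if m = - J then 0\<^sub>v n
           else complex_of_real (sqrt ((J + m) * (J - m + 1))) \<cdot>\<^sub>v ket (m - 1)))"

section \<open>Probe states\<close>

definition probe_vec0 :: "(real \<Rightarrow> complex vec) \<Rightarrow> real \<Rightarrow> complex vec" where
  "probe_vec0 ket M = complex_of_real (1 / sqrt 2) \<cdot>\<^sub>v (ket M + ket (- M))"

definition probe_vec :: "complex mat \<Rightarrow> (real \<Rightarrow> complex vec) \<Rightarrow> real \<Rightarrow> real \<Rightarrow> complex vec" where
  "probe_vec Qz ket M \<theta> = mat_exp ((- \<i> * complex_of_real \<theta>) \<cdot>\<^sub>m Qz) *\<^sub>v probe_vec0 ket M"

definition probe_state :: "complex mat \<Rightarrow> (real \<Rightarrow> complex vec) \<Rightarrow> real \<Rightarrow> real \<Rightarrow> complex mat" where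
  "probe_state Qz ket M \<theta> = ket_bra (probe_vec Qz ket M \<theta>)"

definition probe_deriv :: "complex mat \<Rightarrow> (real \<Rightarrow> complex vec) \<Rightarrow> real \<Rightarrow> real \<Rightarrow> complex mat" where
  "probe_deriv Qz ket M \<theta> = (- \<i>) \<cdot>\<^sub>m commutator Qz (probe_state Qz ket M \<theta>)"

section \<open>Noise\<close>

definition apply_channel :: "nat \<Rightarrow> complex mat list \<Rightarrow> complex mat \<Rightarrow> complex mat" where
  "apply_channel n Ks \<rho> = mat_sum n (map (\<lambda>K. K * \<rho> * mat_adjoint K) Ks)"

definition noise_channel_on :: "nat \<Rightarrow> nat \<Rightarrow> nat set \<Rightarrow> complex mat list \<Rightarrow> bool" where
  "noise_channel_on N D A Ks \<longleftrightarrow>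
     (\<forall>K\<in>set Ks. \<exists>k. K = local_op N D A k) \<and>
     mat_sum (D ^ N) (map (\<lambda>K. mat_adjoint K * K) Ks) = 1\<^sub>m (D ^ N)"

section \<open>Quantum Fisher information\<close>

definition is_sld :: "complex mat \<Rightarrow> complex mat \<Rightarrow> complex mat \<Rightarrow> bool" where
  "is_sld \<rho> \<rho>' R \<longleftrightarrow>
     R \<in> carrier_mat (dim_row \<rho>) (dim_row \<rho>) \<and> hermitian R \<and> \<rho> * R + R * \<rho> = 2 \<cdot>\<^sub>m \<rho>'"

text \<open>The value does not depend on the choice of \<open>R\<close>, and the trace is real for Hermitian \<open>\<rho>\<close>;
  \<open>Re\<close> only changes the type.\<close>

definition qfi :: "complex mat \<Rightarrow> complex mat \<Rightarrow> real" where
  "qfi \<rho> \<rho>' = Re (mat_trace (\<rho> * (let R = (SOME R. is_sld \<rho> \<rho>' R) in R * R)))"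

definition noisy_qfi ::
  "nat \<Rightarrow> nat \<Rightarrow> complex mat \<Rightarrow> (real \<Rightarrow> complex vec) \<Rightarrow> real \<Rightarrow> complex mat list \<Rightarrow> real \<Rightarrow> real" where
  "noisy_qfi N D qz ket M Ks \<theta> =
     qfi (apply_channel (D ^ N) Ks (probe_state (total_op N D qz) ket M \<theta>))
         (apply_channel (D ^ N) Ks (probe_deriv (total_op N D qz) ket M \<theta>))"

end

(* The d affected qudits are simply ignored. Let Q_B be the part of Q^- that acts on the
   complement B of the affected set A. Since Q_A^- commutes with Q_B and has norm O(d), while
   the ladder coefficients between |J,M> and |J,-M> are at least of order J, a normalised power
   U = Q_B^(2M) / prod c maps |J,M> to |J,-M> up to an error (1 + O(d/J))^(2M) - 1, which tends to 0
   because d M / J does; on |J,-M> it is close to a multiple of |J,-3M>. The observable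
   X = z U + h.c. with a suitable phase z lives on B, hence commutes with all Kraus operators, and
   the Cauchy-Schwarz bound |Tr(rho' X)|^2 <= F Tr(rho X^2) gives F >= M^2 / 25.
   Cauchy-Schwarz applied to the symmetric logarithmic derivative R itself gives F <= 8 M^2.
   The existence of R (needed because the Fisher information chooses one) is the Fredholm
   alternative for the self-adjoint linear map R |-> rho R + R rho. *)
theory Submission
  imports Defs "HOL-Real_Asymp.Real_Asymp"
begin

unbundle no vec_syntax and no inner_syntax and no fps_syntax

section \<open>Hermitian inner product on coordinate vectors\<close>

text \<open>The multiplet may be superposed over many copies of the irrep, so reduced states and
  matrix elements of local operators are unknown; only the ladder relations and the size of
  \<open>A\<close> are available. Discarding Q_A from a high power of Q^- looks dangerous: the norm
  of Q_B can exceed J, and 2M factors could amplify any error. Commutation with Q_A avoids this,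
  since every power of Q_B then stays next to a ket, where it is compared with a product of ladder
  coefficients. The window from M to -M is where these coefficients are largest. So the product over
  it is the right normalisation for the wanted transition and also keeps the unwanted images, near
  the kets at -3M and 3M, bounded; those kets are orthogonal to the probe and its derivative. For an
  observable commuting with the noise, completeness collapses every sum over Kraus operators to one
  inner product of pure-state vectors, so neither their number nor their form matters. The phase z
  follows theta because the signal of U + h.c. oscillates with theta. The noiseless Fisher
  information is 4 M^2; the constants 1/25 and 8 come from crude norm estimates.\<close>

definition vnorm :: "complex vec \<Rightarrow> real" where
  "vnorm v = L2_set (\<lambda>i. cmod (v $ i)) {..<dim_vec v}"

lemma inner_conv_sum:
  assumes "w \<in> carrier_vec n"
  shows "v \<bullet>c w = (\<Sum>i<n. v $ i * cnj (w $ i))"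
  using assms by (auto simp: scalar_prod_def atLeast0LessThan intro!: sum.cong)

lemma vnorm_nonneg [simp]: "0 \<le> vnorm v"
  by (simp add: vnorm_def)

lemma inner_self: "v \<bullet>c v = complex_of_real ((vnorm v)\<^sup>2)"
  by (simp add: inner_conv_sum[OF carrier_vec_dim_vec] vnorm_def L2_set_def sum_nonneg
      complex_norm_square[symmetric])

lemma inner_Cauchy_Schwarz:
  fixes v w :: "complex vec"
  assumes "v \<in> carrier_vec n" "w \<in> carrier_vec n"
  shows "cmod (v \<bullet>c w) \<le> vnorm v * vnorm w"
proof -
  have "cmod (v \<bullet>c w) \<le> (\<Sum>i<n. \<bar>cmod (v $ i)\<bar> * \<bar>cmod (w $ i)\<bar>)"
    unfolding inner_conv_sum[OF assms(2)]
    by (rule order_trans[OF norm_sum]) (simp add: norm_mult)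
  also have "\<dots> \<le> vnorm v * vnorm w"
    using L2_set_mult_ineq[of "\<lambda>i. cmod (v $ i)" "\<lambda>i. cmod (w $ i)" "{..<n}"] assms
    by (simp add: vnorm_def)
  finally show ?thesis .
qed

lemma vnorm_add:
  fixes v w :: "complex vec"
  assumes "v \<in> carrier_vec n" "w \<in> carrier_vec n"
  shows "vnorm (v + w) \<le> vnorm v + vnorm w"
proof -
  have "vnorm (v + w) \<le> L2_set (\<lambda>i. cmod (v $ i) + cmod (w $ i)) {..<n}"
    unfolding vnorm_def using assms by (auto intro!: L2_set_mono norm_triangle_ineq)
  also have "\<dots> \<le> vnorm v + vnorm w"
    using L2_set_triangle_ineq[of "\<lambda>i. cmod (v $ i)" "\<lambda>i. cmod (w $ i)" "{..<n}"] assms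
    by (simp add: vnorm_def)
  finally show ?thesis .
qed

lemma vnorm_smult: "vnorm (c \<cdot>\<^sub>v v) = cmod c * vnorm v"
  unfolding vnorm_def
  by (subst L2_set_right_distrib) (auto simp: norm_mult intro!: L2_set_cong)

lemma vnorm_diff:
  fixes v w :: "complex vec"
  assumes "v \<in> carrier_vec n" "w \<in> carrier_vec n"
  shows "vnorm (v - w) \<le> vnorm v + vnorm w"
proof -
  have "v - w = v + (-1) \<cdot>\<^sub>v w" using assms by auto
  then show ?thesis
    using vnorm_add[of v n "(-1) \<cdot>\<^sub>v w"] vnorm_smult[of "-1" w] assms by simp
qed

lemma inner_add_left:
  fixes u v w :: "complex vec"
  assumes "u \<in> carrier_vec n" "v \<in> carrier_vec n" "w \<in> carrier_vec n"
  shows "(u + v) \<bullet>c w = u \<bullet>c w + v \<bullet>c w"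
  using assms by (simp add: inner_conv_sum[of _ n] algebra_simps sum.distrib)

lemma inner_add_right:
  fixes u v w :: "complex vec"
  assumes "u \<in> carrier_vec n" "v \<in> carrier_vec n" "w \<in> carrier_vec n"
  shows "u \<bullet>c (v + w) = u \<bullet>c v + u \<bullet>c w"
  using assms by (simp add: inner_conv_sum[of _ n] algebra_simps sum.distrib)

lemma inner_smult_left:
  fixes u v :: "complex vec"
  assumes "u \<in> carrier_vec n" "v \<in> carrier_vec n"
  shows "(a \<cdot>\<^sub>v u) \<bullet>c v = a * (u \<bullet>c v)"
  using assms by (simp add: inner_conv_sum[of _ n] algebra_simps sum_distrib_left)

lemma inner_smult_right:
  fixes u v :: "complex vec"
  assumes "u \<in> carrier_vec n" "v \<in> carrier_vec n"
  shows "u \<bullet>c (a \<cdot>\<^sub>v v) = cnj a * (u \<bullet>c v)"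
  using assms by (simp add: inner_conv_sum[of _ n] algebra_simps sum_distrib_left)

lemma inner_commute:
  fixes u v :: "complex vec"
  assumes "u \<in> carrier_vec n" "v \<in> carrier_vec n"
  shows "v \<bullet>c u = cnj (u \<bullet>c v)"
  using assms by (simp add: inner_conv_sum[of _ n] mult.commute)

section \<open>Adjoints, entries and sums of square matrices\<close>

lemma dim_mat_adjoint [simp]:
  "dim_row (mat_adjoint A) = dim_col A" "dim_col (mat_adjoint A) = dim_row A"
  by (simp_all add: mat_adjoint_def)

lemma mat_adjoint_carrier [simp]: "A \<in> carrier_mat m n \<Longrightarrow> mat_adjoint A \<in> carrier_mat n m"
  by (auto intro!: carrier_matI)

lemma mat_adjoint_index [simp]:
  "i < dim_col A \<Longrightarrow> j < dim_row A \<Longrightarrow> mat_adjoint A $$ (i, j) = cnj (A $$ (j, i))"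
  by (simp add: mat_adjoint_def mat_of_rows_index)

lemma square_mult_carrier [simp]:
  "A \<in> carrier_mat n n \<Longrightarrow> B \<in> carrier_mat n n \<Longrightarrow> A * B \<in> carrier_mat n n"
  by (rule mult_carrier_mat)

lemma square_mult_vec_carrier [simp]:
  "A \<in> carrier_mat n n \<Longrightarrow> v \<in> carrier_vec n \<Longrightarrow> A *\<^sub>v v \<in> carrier_vec n"
  by (rule mult_mat_vec_carrier)

lemma mat_vec_index:
  assumes "A \<in> carrier_mat n n" "v \<in> carrier_vec n" "i < n"
  shows "(A *\<^sub>v v) $ i = (\<Sum>j<n. A $$ (i, j) * v $ j)"
  using assms by (simp add: scalar_prod_def atLeast0LessThan)

lemma mat_mult_index:
  assumes "A \<in> carrier_mat n n" "B \<in> carrier_mat n n" "i < n" "j < n"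
  shows "(A * B) $$ (i, j) = (\<Sum>k<n. A $$ (i, k) * B $$ (k, j))"
  using assms by (simp add: scalar_prod_def atLeast0LessThan)

lemma inner_mat_adjoint:
  fixes v w :: "complex vec"
  assumes "A \<in> carrier_mat n n" "v \<in> carrier_vec n" "w \<in> carrier_vec n"
  shows "(A *\<^sub>v v) \<bullet>c w = v \<bullet>c (mat_adjoint A *\<^sub>v w)"
proof -
  have "(A *\<^sub>v v) \<bullet>c w = (\<Sum>i<n. \<Sum>j<n. A $$ (i, j) * v $ j * cnj (w $ i))"
    unfolding inner_conv_sum[OF assms(3)]
    by (rule sum.cong) (simp_all only: lessThan_iff mat_vec_index[OF assms(1,2)] sum_distrib_right)
  also have "\<dots> = (\<Sum>j<n. \<Sum>i<n. A $$ (i, j) * v $ j * cnj (w $ i))"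
    by (rule sum.swap)
  also have "\<dots> = (\<Sum>j<n. v $ j * cnj ((mat_adjoint A *\<^sub>v w) $ j))"
    using assms
    by (intro sum.cong) (auto simp: mat_vec_index[OF mat_adjoint_carrier[OF assms(1)] assms(3)]
        sum_distrib_left mult_ac simp del: index_mult_mat_vec intro!: sum.cong)
  also have "\<dots> = v \<bullet>c (mat_adjoint A *\<^sub>v w)"
    using assms by (intro inner_conv_sum[symmetric]) simp
  finally show ?thesis .
qed

lemma mat_sum_carrier:
  assumes "\<And>A. A \<in> set As \<Longrightarrow> A \<in> carrier_mat n n"
  shows "mat_sum n As \<in> carrier_mat n n"
  using assms by (induction As) (auto simp: mat_sum_def)

lemma mat_sum_index:
  assumes "\<And>A. A \<in> set As \<Longrightarrow> A \<in> carrier_mat n n" "i < n" "j < n"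
  shows "mat_sum n As $$ (i, j) = (\<Sum>A\<leftarrow>As. A $$ (i, j))"
  using assms(1)
proof (induction As)
  case Nil
  then show ?case using assms(2,3) by (simp add: mat_sum_def)
next
  case (Cons A As)
  have "mat_sum n As \<in> carrier_mat n n" using Cons.prems by (intro mat_sum_carrier) auto
  then show ?case using Cons assms(2,3) by (simp add: mat_sum_def)
qed

lemma mat_sum_map_index:
  assumes "\<And>A. A \<in> set As \<Longrightarrow> f A \<in> carrier_mat n n" "i < n" "j < n"
  shows "mat_sum n (map f As) $$ (i, j) = (\<Sum>k<length As. f (As ! k) $$ (i, j))"
  by (subst mat_sum_index) (use assms in \<open>auto simp: sum_list_sum_nth atLeast0LessThan o_def\<close>)

section \<open>Hermitian linear systems\<close>

text \<open>Orthogonal projection onto a finite span, by Gram-Schmidt along \<open>F\<close>. The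
  vectors may be linearly dependent, which matters because they will be the columns of a possibly
  singular matrix.\<close>

lemma least_squares_exists:
  fixes v :: "'k \<Rightarrow> 'i \<Rightarrow> complex"
  assumes "finite I" "finite F"
  shows "\<exists>c. \<forall>k\<in>F. (\<Sum>i\<in>I. (t i - (\<Sum>j\<in>F. c j * v j i)) * cnj (v k i)) = 0"
  using assms(2)
proof (induction F arbitrary: t rule: finite_induct)
  case empty
  then show ?case by simp
next
  case (insert l F)
  obtain c where c: "\<And>k. k \<in> F \<Longrightarrow> (\<Sum>i\<in>I. (t i - (\<Sum>j\<in>F. c j * v j i)) * cnj (v k i)) = 0"
    using insert.IH[of t] by blast
  obtain e where e: "\<And>k. k \<in> F \<Longrightarrow> (\<Sum>i\<in>I. (v l i - (\<Sum>j\<in>F. e j * v j i)) * cnj (v k i)) = 0"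
    using insert.IH[of "v l"] by blast
  define r where "r i = t i - (\<Sum>j\<in>F. c j * v j i)" for i
  define p where "p i = v l i - (\<Sum>j\<in>F. e j * v j i)" for i
  \<comment> \<open>The residual \<open>r\<close> loses its component along \<open>p\<close>, the
    part of \<open>v l\<close> orthogonal to the older vectors. If \<open>p\<close> vanishes on
    \<open>I\<close>, division by zero makes \<open>s\<close> equal to 0, and \<open>pp\<close>
    covers this case.\<close>
  define s where "s = (\<Sum>i\<in>I. r i * cnj (p i)) / (\<Sum>i\<in>I. p i * cnj (p i))"
  have rF: "(\<Sum>i\<in>I. r i * cnj (v k i)) = 0" if "k \<in> F" for k using c[OF that] by (simp add: r_def)
  have pF: "(\<Sum>i\<in>I. p i * cnj (v k i)) = 0" if "k \<in> F" for k using e[OF that] by (simp add: p_def)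
  have vl: "v l i = p i + (\<Sum>j\<in>F. e j * v j i)" for i by (simp add: p_def)
  \<comment> \<open>Against anything orthogonal to the older vectors, \<open>v l\<close> and
    \<open>p\<close> have the same inner product, so testing with \<open>p\<close> is
    enough.\<close>
  have orth: "(\<Sum>i\<in>I. f i * cnj (v l i)) = (\<Sum>i\<in>I. f i * cnj (p i))"
    if f: "\<And>k. k \<in> F \<Longrightarrow> (\<Sum>i\<in>I. f i * cnj (v k i)) = 0" for f
  proof -
    have "(\<Sum>i\<in>I. f i * cnj (v l i)) =
        (\<Sum>i\<in>I. f i * cnj (p i)) + (\<Sum>i\<in>I. \<Sum>j\<in>F. cnj (e j) * (f i * cnj (v j i)))"
      unfolding vl by (simp add: algebra_simps sum.distrib sum_distrib_left)
    also have "(\<Sum>i\<in>I. \<Sum>j\<in>F. cnj (e j) * (f i * cnj (v j i))) =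
        (\<Sum>j\<in>F. cnj (e j) * (\<Sum>i\<in>I. f i * cnj (v j i)))"
      by (subst sum.swap) (simp add: sum_distrib_left)
    also have "\<dots> = 0" using f by simp
    finally show ?thesis by simp
  qed
  have sF: "(\<Sum>i\<in>I. (r i - s * p i) * cnj (v k i)) = 0" if "k \<in> F" for k
  proof -
    have "(\<Sum>i\<in>I. (r i - s * p i) * cnj (v k i)) =
        (\<Sum>i\<in>I. r i * cnj (v k i)) - s * (\<Sum>i\<in>I. p i * cnj (v k i))"
      by (simp add: algebra_simps sum_subtractf sum_distrib_left)
    then show ?thesis using rF[OF that] pF[OF that] by simp
  qed
  have pp: "(\<Sum>i\<in>I. r i * cnj (p i)) = 0" if "(\<Sum>i\<in>I. p i * cnj (p i)) = 0"
  proof -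
    have "(\<Sum>i\<in>I. (cmod (p i))\<^sup>2) = 0"
      using that by (simp add: complex_norm_square[symmetric] flip: of_real_power of_real_sum)
    then have "\<forall>i\<in>I. p i = 0" using assms(1) by (simp add: sum_nonneg_eq_0_iff)
    then show ?thesis by simp
  qed
  have "(\<Sum>i\<in>I. (r i - s * p i) * cnj (v l i)) =
      (\<Sum>i\<in>I. r i * cnj (p i)) - s * (\<Sum>i\<in>I. p i * cnj (p i))"
    by (subst orth[OF sF]) (simp_all add: algebra_simps sum_subtractf sum_distrib_left)
  also have "\<dots> = 0" using pp by (auto simp: s_def)
  finally have sl: "(\<Sum>i\<in>I. (r i - s * p i) * cnj (v l i)) = 0" .
  define c' where "c' j = (if j = l then s else c j - s * e j)" for j
  have "t i - (\<Sum>j\<in>insert l F. c' j * v j i) = r i - s * p i" for i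
  proof -
    have "(\<Sum>j\<in>F. c' j * v j i) = (\<Sum>j\<in>F. c j * v j i - s * (e j * v j i))"
      using insert.hyps by (intro sum.cong) (auto simp: c'_def algebra_simps)
    then show ?thesis using insert.hyps
      by (simp add: c'_def r_def p_def algebra_simps sum_subtractf sum_distrib_left)
  qed
  then show ?case using sF sl by (intro exI[of _ c']) auto
qed

text \<open>Fredholm alternative: the least-squares residual \<open>r\<close> is orthogonal to the
  range of \<open>a\<close>, hence in its kernel because \<open>a\<close> is Hermitian. By
  \<open>ker\<close> it is then orthogonal to \<open>t\<close> as well, so orthogonal to
  itself.\<close>

lemma hermitian_system_solvable:
  fixes a :: "'i \<Rightarrow> 'i \<Rightarrow> complex"
  assumes fin: "finite I"
    and herm: "\<And>i j. i \<in> I \<Longrightarrow> j \<in> I \<Longrightarrow> a i j = cnj (a j i)"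
    and ker: "\<And>y. (\<And>i. i \<in> I \<Longrightarrow> (\<Sum>j\<in>I. a i j * y j) = 0) \<Longrightarrow> (\<Sum>i\<in>I. t i * cnj (y i)) = 0"
  shows "\<exists>x. \<forall>i\<in>I. (\<Sum>j\<in>I. a i j * x j) = t i"
proof -
  obtain c where c: "\<And>k. k \<in> I \<Longrightarrow> (\<Sum>i\<in>I. (t i - (\<Sum>j\<in>I. c j * a i j)) * cnj (a i k)) = 0"
    using least_squares_exists[OF fin fin, of t "\<lambda>j i. a i j"] by blast
  define r where "r i = t i - (\<Sum>j\<in>I. c j * a i j)" for i
  have rker: "(\<Sum>j\<in>I. a i j * r j) = 0" if i: "i \<in> I" for i
  proof -
    have "(\<Sum>j\<in>I. a i j * r j) = (\<Sum>j\<in>I. r j * cnj (a j i))"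
      using herm[OF i] by (intro sum.cong) auto
    then show ?thesis using c[OF i] by (simp add: r_def)
  qed
  have "(\<Sum>i\<in>I. r i * cnj (r i)) =
      (\<Sum>i\<in>I. t i * cnj (r i)) - (\<Sum>i\<in>I. \<Sum>j\<in>I. c j * a i j * cnj (r i))"
    by (subst r_def) (simp add: algebra_simps sum_subtractf sum_distrib_left sum_distrib_right)
  also have "(\<Sum>i\<in>I. \<Sum>j\<in>I. c j * a i j * cnj (r i)) = (\<Sum>j\<in>I. c j * cnj (\<Sum>i\<in>I. a j i * r i))"
    by (subst sum.swap)
      (auto simp: sum_distrib_left mult.assoc intro!: sum.cong, metis herm complex_cnj_cnj)
  also have "\<dots> = 0" using rker by simp
  also have "(\<Sum>i\<in>I. t i * cnj (r i)) = 0" by (rule ker) (rule rker)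
  finally have "(\<Sum>i\<in>I. (cmod (r i))\<^sup>2) = 0"
    by (simp add: complex_norm_square[symmetric] flip: of_real_power of_real_sum)
  then have "\<forall>i\<in>I. r i = 0" using fin by (simp add: sum_nonneg_eq_0_iff)
  then show ?thesis
    by (intro exI[of _ c]) (auto simp: r_def mult.commute)
qed

section \<open>Quantum Fisher information of a sum of rank-one operators\<close>

text \<open>The common shape of both arguments of \<open>qfi\<close>: a channel applied to |a><b|
  yields such a sum, with one term per Kraus operator.\<close>

definition outer_sum :: "nat \<Rightarrow> nat \<Rightarrow> (nat \<Rightarrow> complex vec) \<Rightarrow> (nat \<Rightarrow> complex vec) \<Rightarrow> complex mat" where
  "outer_sum n m u w = mat n n (\<lambda>(x, y). \<Sum>j<m. u j $ x * cnj (w j $ y))"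

lemma outer_sum_carrier [simp]: "outer_sum n m u w \<in> carrier_mat n n"
  by (simp add: outer_sum_def)

lemma mat_trace_conv_sum: "A \<in> carrier_mat n n \<Longrightarrow> mat_trace A = (\<Sum>i<n. A $$ (i, i))"
  by (simp add: mat_trace_def diag_mat_def sum_list_sum_nth atLeast0LessThan)

lemma mat_trace_outer_sum_mult:
  assumes Y: "Y \<in> carrier_mat n n"
    and u: "\<And>j. u j \<in> carrier_vec n" and w: "\<And>j. w j \<in> carrier_vec n"
  shows "mat_trace (outer_sum n m u w * Y) = (\<Sum>j<m. (Y *\<^sub>v u j) \<bullet>c w j)"
proof -
  have "mat_trace (outer_sum n m u w * Y) =
      (\<Sum>x<n. \<Sum>y<n. \<Sum>j<m. u j $ x * cnj (w j $ y) * Y $$ (y, x))"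
    using Y outer_sum_carrier[of n m u w] by (subst mat_trace_conv_sum[of _ n])
      (auto simp: mat_mult_index[of _ n] sum_distrib_right simp del: index_mult_mat,
        simp add: outer_sum_def sum_distrib_right)
  also have "\<dots> = (\<Sum>y<n. \<Sum>x<n. \<Sum>j<m. u j $ x * cnj (w j $ y) * Y $$ (y, x))"
    by (rule sum.swap)
  also have "\<dots> = (\<Sum>y<n. \<Sum>j<m. \<Sum>x<n. u j $ x * cnj (w j $ y) * Y $$ (y, x))"
    by (intro sum.cong refl sum.swap)
  also have "\<dots> = (\<Sum>j<m. \<Sum>y<n. \<Sum>x<n. u j $ x * cnj (w j $ y) * Y $$ (y, x))"
    by (rule sum.swap)
  also have "\<dots> = (\<Sum>j<m. (Y *\<^sub>v u j) \<bullet>c w j)"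
    by (intro sum.cong refl)
      (auto simp: inner_conv_sum[OF w] mat_vec_index[OF Y u] sum_distrib_right sum_distrib_left
        mult_ac simp del: index_mult_mat_vec intro!: sum.cong)
  finally show ?thesis .
qed

lemma mat_trace_add:
  "A \<in> carrier_mat n n \<Longrightarrow> B \<in> carrier_mat n n \<Longrightarrow> mat_trace (A + B) = mat_trace A + mat_trace B"
  by (simp add: mat_trace_conv_sum[of _ n] sum.distrib)

lemma mat_trace_smult: "A \<in> carrier_mat n n \<Longrightarrow> mat_trace (c \<cdot>\<^sub>m A) = c * mat_trace A"
  by (simp add: mat_trace_conv_sum[of _ n] sum_distrib_left)

lemma mat_trace_mult_commute:
  assumes "A \<in> carrier_mat n n" "B \<in> carrier_mat n n"
  shows "mat_trace (A * B) = mat_trace (B * A)"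
proof -
  have "mat_trace (A * B) = (\<Sum>i<n. \<Sum>k<n. A $$ (i, k) * B $$ (k, i))"
    using assms by (simp add: mat_trace_conv_sum[of _ n] mat_mult_index[of _ n] del: index_mult_mat)
  also have "\<dots> = (\<Sum>k<n. \<Sum>i<n. B $$ (k, i) * A $$ (i, k))"
    by (subst sum.swap) (simp add: mult.commute)
  also have "\<dots> = mat_trace (B * A)"
    using assms by (simp add: mat_trace_conv_sum[of _ n] mat_mult_index[of _ n] del: index_mult_mat)
  finally show ?thesis .
qed

lemma hermitian_inner:
  fixes v w :: "complex vec"
  assumes "hermitian A" "A \<in> carrier_mat n n" "v \<in> carrier_vec n" "w \<in> carrier_vec n"
  shows "(A *\<^sub>v v) \<bullet>c w = v \<bullet>c (A *\<^sub>v w)"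
  using inner_mat_adjoint[OF assms(2-4)] assms(1) by (simp add: hermitian_def)

text \<open>A state in factored form whose vectors \<open>u j\<close> move with velocity
  \<open>w j\<close>; \<open>\<sigma>'\<close> below is the product rule. Norms of these vectors
  take the place of a spectral decomposition.\<close>

locale outer_sum_derivative =
  fixes n m :: nat and u w :: "nat \<Rightarrow> complex vec"
  assumes u: "\<And>j. u j \<in> carrier_vec n" and w: "\<And>j. w j \<in> carrier_vec n"
begin

definition \<sigma> :: "complex mat" where "\<sigma> = outer_sum n m u u"

definition \<sigma>' :: "complex mat" where "\<sigma>' = outer_sum n m w u + outer_sum n m u w"

lemma carrier [simp]: "\<sigma> \<in> carrier_mat n n" "\<sigma>' \<in> carrier_mat n n"
  by (simp_all add: \<sigma>_def \<sigma>'_def)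

lemma dims [simp]: "dim_row \<sigma> = n" "dim_col \<sigma> = n" "dim_row \<sigma>' = n" "dim_col \<sigma>' = n"
  using carrier by blast+

lemma is_sld_carrier: "is_sld \<sigma> \<sigma>' R \<Longrightarrow> R \<in> carrier_mat n n"
  using carrier(1) by (auto simp: is_sld_def)

text \<open>Trace the defining equation of \<open>R\<close> against a test observable
  \<open>X\<close> and move factors cyclically. In effect \<open>R *\<^sub>v u j\<close> stands in
  for twice \<open>w j\<close>; both bounds on the Fisher information come from a choice of
  \<open>X\<close>.\<close>

lemma sld_inner:
  assumes R: "is_sld \<sigma> \<sigma>' R" and X: "X \<in> carrier_mat n n" "hermitian X"
  shows "(\<Sum>j<m. 2 * Re ((X *\<^sub>v u j) \<bullet>c w j)) = (\<Sum>j<m. Re ((X *\<^sub>v u j) \<bullet>c (R *\<^sub>v u j)))"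
proof -
  have Rc: "R \<in> carrier_mat n n" and Rh: "hermitian R" and eq: "\<sigma> * R + R * \<sigma> = 2 \<cdot>\<^sub>m \<sigma>'"
    using R is_sld_carrier[OF R] by (auto simp: is_sld_def)
  have tr_comm: "mat_trace (R * \<sigma> * X) = mat_trace (\<sigma> * (X * R))"
  proof -
    have "mat_trace (R * \<sigma> * X) = mat_trace (R * (\<sigma> * X))"
      using Rc X by (simp add: assoc_mult_mat[of _ n n _ n _ n])
    also have "\<dots> = mat_trace ((\<sigma> * X) * R)"
      using Rc X by (intro mat_trace_mult_commute[of _ n]) simp_all
    also have "\<dots> = mat_trace (\<sigma> * (X * R))"
      using Rc X by (simp add: assoc_mult_mat[of _ n n _ n _ n])
    finally show ?thesis .
  qed
  have "2 * mat_trace (\<sigma>' * X) = mat_trace ((\<sigma> * R + R * \<sigma>) * X)"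
    unfolding eq using X by (simp add: mat_trace_smult[of _ n] mult_smult_assoc_mat[of _ n n _ n])
  also have "\<dots> = mat_trace (\<sigma> * (R * X)) + mat_trace (\<sigma> * (X * R))"
    unfolding tr_comm[symmetric] using Rc X
    by (simp add: add_mult_distrib_mat[of _ n n] mat_trace_add[of _ n] assoc_mult_mat[of _ n n _ n _ n])
  also have "\<dots> = (\<Sum>j<m. (R *\<^sub>v (X *\<^sub>v u j)) \<bullet>c u j) + (\<Sum>j<m. (X *\<^sub>v (R *\<^sub>v u j)) \<bullet>c u j)"
    unfolding \<sigma>_def using Rc X u by (simp add: mat_trace_outer_sum_mult assoc_mult_mat_vec[of _ n n _ n])
  also have "\<dots> = (\<Sum>j<m. (X *\<^sub>v u j) \<bullet>c (R *\<^sub>v u j) + (R *\<^sub>v u j) \<bullet>c (X *\<^sub>v u j))"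
    unfolding sum.distrib[symmetric]
    using hermitian_inner[OF Rh Rc mult_mat_vec_carrier[OF X(1) u] u]
      hermitian_inner[OF X(2,1) mult_mat_vec_carrier[OF Rc u] u]
    by simp
  finally have 1: "2 * Re (mat_trace (\<sigma>' * X)) = (\<Sum>j<m. 2 * Re ((X *\<^sub>v u j) \<bullet>c (R *\<^sub>v u j)))"
    using inner_commute[OF mult_mat_vec_carrier[OF X(1) u] mult_mat_vec_carrier[OF Rc u]]
    by (auto dest!: arg_cong[where f = Re] simp: sum_distrib_left intro!: sum.cong)
  have "mat_trace (\<sigma>' * X) = (\<Sum>j<m. (X *\<^sub>v w j) \<bullet>c u j) + (\<Sum>j<m. (X *\<^sub>v u j) \<bullet>c w j)"
    unfolding \<sigma>'_def using X u w
    by (simp add: add_mult_distrib_mat[of _ n n] mat_trace_add[of _ n] mat_trace_outer_sum_mult)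
  also have "\<dots> = (\<Sum>j<m. w j \<bullet>c (X *\<^sub>v u j) + (X *\<^sub>v u j) \<bullet>c w j)"
    unfolding sum.distrib[symmetric] using hermitian_inner[OF X(2,1) w u] by simp
  finally have 2: "Re (mat_trace (\<sigma>' * X)) = (\<Sum>j<m. 2 * Re ((X *\<^sub>v u j) \<bullet>c w j))"
    using inner_commute[OF mult_mat_vec_carrier[OF X(1) u] w]
    by (auto simp: sum_distrib_left intro!: sum.cong)
  show ?thesis using 1 2 by (simp add: sum_distrib_left[symmetric])
qed

text \<open>The map R -> \<sigma> R + R \<sigma> is Hermitian for the Hilbert-Schmidt product but
  singular when \<sigma> is far from full rank, so \<open>\<sigma>'\<close> must be orthogonal to
  its kernel. It is: each term of \<open>\<sigma>'\<close> has a factor \<open>u j\<close>, and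
  kernel elements and their adjoints annihilate every \<open>u j\<close>.\<close>

lemma sld_exists: "\<exists>R. is_sld \<sigma> \<sigma>' R"
proof -
  define I where "I = {..<n} \<times> {..<n}"
  \<comment> \<open>The matrix of this map over index pairs: left multiplication acts on the row
    index, right multiplication on the column index.\<close>
  define a where "a = (\<lambda>(x, y) (x', y').
    (if y = y' then \<sigma> $$ (x, x') else 0) + (if x = x' then \<sigma> $$ (y', y) else 0))"
  have \<sigma>h: "cnj (\<sigma> $$ (y, x)) = \<sigma> $$ (x, y)" if "x < n" "y < n" for x y
    using that by (simp add: \<sigma>_def outer_sum_def mult.commute)
  have \<sigma>'h: "cnj (\<sigma>' $$ (y, x)) = \<sigma>' $$ (x, y)" if "x < n" "y < n" for x y
    using that by (simp add: \<sigma>'_def outer_sum_def mult.commute add.commute)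
  have a_sum: "(\<Sum>k\<in>I. a (x, y) k * f k) = (\<sigma> * Y + Y * \<sigma>) $$ (x, y)"
    if "x < n" "y < n" "Y = mat n n f" for x y f Y
  proof -
    have "(\<Sum>k\<in>I. a (x, y) k * f k) =
        (\<Sum>x'<n. \<Sum>y'<n. (if y = y' then \<sigma> $$ (x, x') * f (x', y') else 0)) +
        (\<Sum>x'<n. \<Sum>y'<n. (if x = x' then \<sigma> $$ (y', y) * f (x', y') else 0))"
      unfolding I_def sum.distrib[symmetric] sum.cartesian_product
      by (intro sum.cong refl) (auto simp: a_def algebra_simps)
    also have "(\<Sum>x'<n. \<Sum>y'<n. (if x = x' then \<sigma> $$ (y', y) * f (x', y') else 0)) =
        (\<Sum>y'<n. \<Sum>x'<n. (if x = x' then \<sigma> $$ (y', y) * f (x', y') else 0))"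
      by (rule sum.swap)
    finally show ?thesis using that
      by (simp add: mat_mult_index[of _ n] mult.commute del: index_mult_mat(1))
  qed
  have "\<exists>X. \<forall>i\<in>I. (\<Sum>j\<in>I. a i j * X j) = 2 * \<sigma>' $$ i"
  proof (rule hermitian_system_solvable)
    show "finite I" by (simp add: I_def)
    show "a i j = cnj (a j i)" if "i \<in> I" "j \<in> I" for i j
      using that \<sigma>h by (auto simp: a_def I_def)
    fix f assume f: "\<And>i. i \<in> I \<Longrightarrow> (\<Sum>j\<in>I. a i j * f j) = 0"
    define Y where "Y = mat n n f"
    have Yc: "Y \<in> carrier_mat n n" by (simp add: Y_def)
    have Yac: "mat_adjoint Y \<in> carrier_mat n n" using Yc by simp
    have Y0: "\<sigma> * Y + Y * \<sigma> = 0\<^sub>m n n"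
      using f a_sum[OF _ _ Y_def] Yc carrier by (intro eq_matI) (auto simp: I_def)
    \<comment> \<open>Pairing the kernel equation with \<open>Y\<close> gives the sum of the squared
      norms of all images of \<open>u j\<close> under \<open>Y\<close> and under its adjoint; a
      kernel element need not be Hermitian, so both occur.\<close>
    have "mat_trace (\<sigma> * (Y * mat_adjoint Y)) + mat_trace (\<sigma> * (mat_adjoint Y * Y)) =
        mat_trace ((\<sigma> * Y + Y * \<sigma>) * mat_adjoint Y)"
    proof -
      have "mat_trace (Y * \<sigma> * mat_adjoint Y) = mat_trace (mat_adjoint Y * (Y * \<sigma>))"
        using Yc Yac by (intro mat_trace_mult_commute[of _ n]) simp_all
      also have "\<dots> = mat_trace ((mat_adjoint Y * Y) * \<sigma>)"
        using Yc Yac by (simp add: assoc_mult_mat[of _ n n _ n _ n])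
      also have "\<dots> = mat_trace (\<sigma> * (mat_adjoint Y * Y))"
        using Yc Yac by (intro mat_trace_mult_commute[of _ n]) simp_all
      finally show ?thesis using Yc Yac
          add_mult_distrib_mat[of "\<sigma> * Y" n n "Y * \<sigma>" "mat_adjoint Y" n]
        by (simp add: mat_trace_add[of _ n] assoc_mult_mat[of _ n n _ n _ n])
    qed
    also have "\<dots> = 0" unfolding Y0 left_mult_zero_mat[OF Yac] by (simp add: mat_trace_conv_sum[of _ n])
    finally have "(\<Sum>j<m. (Y *\<^sub>v (mat_adjoint Y *\<^sub>v u j)) \<bullet>c u j) +
        (\<Sum>j<m. (mat_adjoint Y *\<^sub>v (Y *\<^sub>v u j)) \<bullet>c u j) = 0"
      unfolding \<sigma>_def using Yc Yac u
      by (simp add: mat_trace_outer_sum_mult assoc_mult_mat_vec[of _ n n _ n])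
    moreover have "(Y *\<^sub>v (mat_adjoint Y *\<^sub>v u j)) \<bullet>c u j =
        complex_of_real ((vnorm (mat_adjoint Y *\<^sub>v u j))\<^sup>2)" for j
      using inner_mat_adjoint[OF Yc mult_mat_vec_carrier[OF Yac u] u] by (simp add: inner_self)
    moreover have "(mat_adjoint Y *\<^sub>v (Y *\<^sub>v u j)) \<bullet>c u j =
        complex_of_real ((vnorm (Y *\<^sub>v u j))\<^sup>2)" for j
    proof -
      have "mat_adjoint (mat_adjoint Y) = Y" using Yc by (intro eq_matI) auto
      then show ?thesis
        using inner_mat_adjoint[OF Yac mult_mat_vec_carrier[OF Yc u] u] by (simp add: inner_self)
    qed
    ultimately have sum0: "(\<Sum>j<m. (vnorm (mat_adjoint Y *\<^sub>v u j))\<^sup>2) + (\<Sum>j<m. (vnorm (Y *\<^sub>v u j))\<^sup>2) = 0"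
      by (simp flip: of_real_power of_real_sum of_real_add)
    have "(\<Sum>j<m. (vnorm (mat_adjoint Y *\<^sub>v u j))\<^sup>2) = 0" "(\<Sum>j<m. (vnorm (Y *\<^sub>v u j))\<^sup>2) = 0"
      using sum0 by (simp_all add: add_nonneg_eq_0_iff sum_nonneg)
    then have n0: "vnorm (mat_adjoint Y *\<^sub>v u j) = 0" "vnorm (Y *\<^sub>v u j) = 0" if "j < m" for j
      using that by (simp_all add: sum_nonneg_eq_0_iff)
    have i0: "(mat_adjoint Y *\<^sub>v u j) \<bullet>c w j = 0" "w j \<bullet>c (Y *\<^sub>v u j) = 0" if "j < m" for j
      using inner_Cauchy_Schwarz[OF mult_mat_vec_carrier[OF Yac u] w, of j j]
        inner_Cauchy_Schwarz[OF w mult_mat_vec_carrier[OF Yc u], of j j] n0[OF that] by auto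
    have "(\<Sum>i\<in>I. \<sigma>' $$ i * cnj (f i)) = mat_trace (\<sigma>' * mat_adjoint Y)"
      using Yac unfolding I_def
      by (subst mat_trace_conv_sum[of _ n])
        (auto simp: mat_mult_index[of _ n] sum.cartesian_product Y_def simp del: index_mult_mat
          intro!: sum.cong)
    also have "\<dots> = (\<Sum>j<m. (mat_adjoint Y *\<^sub>v w j) \<bullet>c u j) + (\<Sum>j<m. (mat_adjoint Y *\<^sub>v u j) \<bullet>c w j)"
      unfolding \<sigma>'_def using Yac u w
      by (simp add: add_mult_distrib_mat[of _ n n] mat_trace_add[of _ n] mat_trace_outer_sum_mult)
    also have "\<dots> = 0"
    proof -
      have "mat_adjoint (mat_adjoint Y) = Y" using Yc by (intro eq_matI) auto
      then show ?thesis using inner_mat_adjoint[OF Yac w u] i0 by simp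
    qed
    finally show "(\<Sum>i\<in>I. 2 * \<sigma>' $$ i * cnj (f i)) = 0"
      by (simp add: mult.assoc sum_distrib_left[symmetric])
  qed
  then obtain f where f: "\<And>i. i \<in> I \<Longrightarrow> (\<Sum>j\<in>I. a i j * f j) = 2 * \<sigma>' $$ i" by blast
  define X where "X = mat n n f"
  have X: "(\<sigma> * X + X * \<sigma>) $$ (x, y) = 2 * \<sigma>' $$ (x, y)" if "x < n" "y < n" for x y
    using f[of "(x, y)"] a_sum[OF that X_def] that by (simp add: I_def)
  \<comment> \<open>The Hermitian part of a solution is again a solution, because \<sigma> and
    \<open>\<sigma>'\<close> are Hermitian.\<close>
  define R where "R = mat n n (\<lambda>(x, y). (X $$ (x, y) + cnj (X $$ (y, x))) / 2)"
  have Xc: "X \<in> carrier_mat n n" and Rc: "R \<in> carrier_mat n n" by (simp_all add: X_def R_def)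
  have "(\<sigma> * R + R * \<sigma>) $$ (x, y) = 2 * \<sigma>' $$ (x, y)" if xy: "x < n" "y < n" for x y
  proof -
    have e: "(\<sigma> * Z + Z * \<sigma>) $$ (x, y) = (\<Sum>k<n. \<sigma> $$ (x, k) * Z $$ (k, y) + Z $$ (x, k) * \<sigma> $$ (k, y))"
      if "Z \<in> carrier_mat n n" "x < n" "y < n" for Z x y
      using that carrier by (simp add: mat_mult_index[of _ n] sum.distrib del: index_mult_mat(1))
    have "(\<sigma> * R + R * \<sigma>) $$ (x, y) =
        (\<Sum>k<n. (\<sigma> $$ (x, k) * X $$ (k, y) + X $$ (x, k) * \<sigma> $$ (k, y)) / 2 +
          cnj (\<sigma> $$ (y, k) * X $$ (k, x) + X $$ (y, k) * \<sigma> $$ (k, x)) / 2)"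
      unfolding e[OF Rc xy]
    proof (intro sum.cong refl)
      fix k assume "k \<in> {..<n}"
      then show "\<sigma> $$ (x, k) * R $$ (k, y) + R $$ (x, k) * \<sigma> $$ (k, y) =
        (\<sigma> $$ (x, k) * X $$ (k, y) + X $$ (x, k) * \<sigma> $$ (k, y)) / 2 +
          cnj (\<sigma> $$ (y, k) * X $$ (k, x) + X $$ (y, k) * \<sigma> $$ (k, x)) / 2"
        using xy \<sigma>h[of x k] \<sigma>h[of k y] by (simp add: R_def field_simps)
    qed
    also have "\<dots> = (\<sigma> * X + X * \<sigma>) $$ (x, y) / 2 + cnj ((\<sigma> * X + X * \<sigma>) $$ (y, x)) / 2"
      unfolding e[OF Xc xy] e[OF Xc xy(2,1)]
      by (simp add: sum.distrib sum_divide_distrib add_divide_distrib)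
    also have "\<dots> = 2 * \<sigma>' $$ (x, y)" using X[OF xy] X[OF xy(2,1)] \<sigma>'h[OF xy] by simp
    finally show ?thesis .
  qed
  then have "\<sigma> * R + R * \<sigma> = 2 \<cdot>\<^sub>m \<sigma>'"
    using carrier Rc by (intro eq_matI) (auto simp del: index_mult_mat(1) index_add_mat(1))
  moreover have "hermitian R"
    unfolding hermitian_def using Rc by (intro eq_matI) (auto simp: R_def add.commute)
  ultimately show ?thesis using Rc carrier by (auto simp: is_sld_def intro!: exI[of _ R])
qed

text \<open>Fixes the operator chosen by \<open>SOME\<close> and turns the Fisher information into
  the squared norm of the family \<open>R *\<^sub>v u j\<close>, on which Cauchy-Schwarz can
  act.\<close>

lemma qfi_conv_sum:
  obtains R where "is_sld \<sigma> \<sigma>' R" "R \<in> carrier_mat n n" "hermitian R"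
    "qfi \<sigma> \<sigma>' = (\<Sum>j<m. (vnorm (R *\<^sub>v u j))\<^sup>2)"
proof -
  define R where "R = (SOME R. is_sld \<sigma> \<sigma>' R)"
  have R: "is_sld \<sigma> \<sigma>' R" unfolding R_def using sld_exists by (rule someI_ex)
  note Rc = is_sld_carrier[OF R]
  have Rh: "hermitian R" using R by (simp add: is_sld_def)
  have "mat_trace (\<sigma> * (R * R)) = (\<Sum>j<m. (R *\<^sub>v u j) \<bullet>c (R *\<^sub>v u j))"
    unfolding \<sigma>_def using Rc u hermitian_inner[OF Rh Rc mult_mat_vec_carrier[OF Rc u] u]
    by (simp add: mat_trace_outer_sum_mult assoc_mult_mat_vec[of _ n n _ n])
  then have "qfi \<sigma> \<sigma>' = (\<Sum>j<m. (vnorm (R *\<^sub>v u j))\<^sup>2)"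
    by (simp add: qfi_def R_def[symmetric] inner_self)
  then show ?thesis using that R Rc Rh by blast
qed

lemma Re_inner_sum_Cauchy_Schwarz:
  assumes "\<And>j. p j \<in> carrier_vec n" "\<And>j. q j \<in> carrier_vec n"
  shows "(\<Sum>j<m. Re (p j \<bullet>c q j))\<^sup>2 \<le> (\<Sum>j<m. (vnorm (p j))\<^sup>2) * (\<Sum>j<m. (vnorm (q j))\<^sup>2)"
proof -
  have "\<bar>\<Sum>j<m. Re (p j \<bullet>c q j)\<bar> \<le> (\<Sum>j<m. vnorm (p j) * vnorm (q j))"
    by (rule order_trans[OF sum_abs sum_mono])
      (rule order_trans[OF abs_Re_le_cmod inner_Cauchy_Schwarz[OF assms]])
  also have "\<dots> \<le> L2_set (\<lambda>j. vnorm (p j)) {..<m} * L2_set (\<lambda>j. vnorm (q j)) {..<m}"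
    using L2_set_mult_ineq[of "\<lambda>j. vnorm (p j)" "\<lambda>j. vnorm (q j)" "{..<m}"] by simp
  finally have "\<bar>\<Sum>j<m. Re (p j \<bullet>c q j)\<bar>\<^sup>2 \<le>
      (L2_set (\<lambda>j. vnorm (p j)) {..<m} * L2_set (\<lambda>j. vnorm (q j)) {..<m})\<^sup>2"
    by (rule power_mono) simp
  then show ?thesis by (simp add: power_mult_distrib L2_set_def sum_nonneg)
qed

text \<open>With \<open>R\<close> itself as test observable, F is twice the real overlap of the
  families R u and w. Cauchy-Schwarz gives F^2 <= 4 F |w|^2, and dividing by F separates the case F
  = 0.\<close>

lemma qfi_le: "qfi \<sigma> \<sigma>' \<le> 4 * (\<Sum>j<m. (vnorm (w j))\<^sup>2)"
proof -
  obtain R where R: "is_sld \<sigma> \<sigma>' R" "R \<in> carrier_mat n n" "hermitian R"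
    and F: "qfi \<sigma> \<sigma>' = (\<Sum>j<m. (vnorm (R *\<^sub>v u j))\<^sup>2)" by (rule qfi_conv_sum)
  have "qfi \<sigma> \<sigma>' = (\<Sum>j<m. Re ((R *\<^sub>v u j) \<bullet>c (R *\<^sub>v u j)))"
    by (simp add: F inner_self)
  also have "\<dots> = 2 * (\<Sum>j<m. Re ((R *\<^sub>v u j) \<bullet>c w j))"
    using sld_inner[OF R] by (simp add: sum_distrib_left)
  finally have "(qfi \<sigma> \<sigma>')\<^sup>2 = 4 * (\<Sum>j<m. Re ((R *\<^sub>v u j) \<bullet>c w j))\<^sup>2"
    by (simp add: power_mult_distrib)
  also have "\<dots> \<le> 4 * (qfi \<sigma> \<sigma>' * (\<Sum>j<m. (vnorm (w j))\<^sup>2))"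
    using Re_inner_sum_Cauchy_Schwarz[of "\<lambda>j. R *\<^sub>v u j" w] mult_mat_vec_carrier[OF R(2) u] w
    by (simp add: F)
  finally have "qfi \<sigma> \<sigma>' * qfi \<sigma> \<sigma>' \<le> qfi \<sigma> \<sigma>' * (4 * (\<Sum>j<m. (vnorm (w j))\<^sup>2))"
    by (simp add: power2_eq_square mult_ac)
  moreover have "qfi \<sigma> \<sigma>' \<ge> 0" by (simp add: F sum_nonneg)
  ultimately show ?thesis
    by (cases "qfi \<sigma> \<sigma>' = 0") (auto simp: sum_nonneg)
qed

text \<open>Error propagation: the left side is the squared rate of change of the mean of
  \<open>X\<close>, and the first factor on the right is its second moment.\<close>

lemma qfi_ge:
  assumes X: "X \<in> carrier_mat n n" "hermitian X"
  shows "4 * (\<Sum>j<m. Re ((X *\<^sub>v u j) \<bullet>c w j))\<^sup>2 \<le> (\<Sum>j<m. (vnorm (X *\<^sub>v u j))\<^sup>2) * qfi \<sigma> \<sigma>'"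
proof -
  obtain R where R: "is_sld \<sigma> \<sigma>' R" "R \<in> carrier_mat n n" "hermitian R"
    and F: "qfi \<sigma> \<sigma>' = (\<Sum>j<m. (vnorm (R *\<^sub>v u j))\<^sup>2)" by (rule qfi_conv_sum)
  have "4 * (\<Sum>j<m. Re ((X *\<^sub>v u j) \<bullet>c w j))\<^sup>2 = (\<Sum>j<m. 2 * Re ((X *\<^sub>v u j) \<bullet>c w j))\<^sup>2"
    by (simp add: sum_distrib_left[symmetric] power_mult_distrib)
  also have "\<dots> = (\<Sum>j<m. Re ((X *\<^sub>v u j) \<bullet>c (R *\<^sub>v u j)))\<^sup>2"
    using sld_inner[OF R(1) X] by simp
  also have "\<dots> \<le> (\<Sum>j<m. (vnorm (X *\<^sub>v u j))\<^sup>2) * qfi \<sigma> \<sigma>'"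
    unfolding F using mult_mat_vec_carrier[OF R(2) u] mult_mat_vec_carrier[OF X(1) u]
    by (intro Re_inner_sum_Cauchy_Schwarz) auto
  finally show ?thesis .
qed

end

section \<open>Operators supported on disjoint sets of sites\<close>

lemma site_0: "site D x 0 = x mod D"
  by (simp add: site_def)

lemma site_Suc: "site D x (Suc i) = site D (x div D) i"
  by (simp add: site_def div_mult2_eq)

lemma site_less: "0 < D \<Longrightarrow> site D x i < D"
  by (simp add: site_def)

lemma site_exists:
  assumes "\<And>i. i < N \<Longrightarrow> f i < D"
  shows "\<exists>z<D ^ N. \<forall>i<N. site D z i = f i"
  using assms
proof (induction N arbitrary: f)
  case 0
  then show ?case by simp
next
  case (Suc N)
  obtain z where z: "z < D ^ N" "\<And>i. i < N \<Longrightarrow> site D z i = f (Suc i)"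
    using Suc.IH[of "f \<circ> Suc"] Suc.prems by auto
  have f0: "f 0 < D" using Suc.prems by simp
  have "f 0 + D * z < D * Suc z" using f0 by simp
  also have "\<dots> \<le> D * D ^ N" using z(1) by (intro mult_le_mono2) simp
  finally have "f 0 + D * z < D ^ Suc N" by simp
  moreover have "site D (f 0 + D * z) i = f i" if "i < Suc N" for i
    using that f0 z(2) by (cases i) (auto simp: site_0 site_Suc)
  ultimately show ?case by blast
qed

lemma site_inject:
  assumes "x < D ^ N" "y < D ^ N" "\<And>i. i < N \<Longrightarrow> site D x i = site D y i"
  shows "x = y"
  using assms
proof (induction N arbitrary: x y)
  case 0
  then show ?case by simp
next
  case (Suc N)
  have "x div D = y div D"
  proof (rule Suc.IH)
    show "x div D < D ^ N" "y div D < D ^ N"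
      using Suc.prems(1,2) by (simp_all add: less_mult_imp_div_less mult.commute)
    show "site D (x div D) i = site D (y div D) i" if "i < N" for i
      using Suc.prems(3)[of "Suc i"] that by (simp add: site_Suc)
  qed
  moreover have "x mod D = y mod D" using Suc.prems(3)[of 0] by (simp add: site_0)
  ultimately show ?case by (metis div_mult_mod_eq)
qed

lemma local_op_carrier [simp]: "local_op N D A k \<in> carrier_mat (D ^ N) (D ^ N)"
  by (simp add: local_op_def)

lemma local_op_index:
  assumes "x < D ^ N" "y < D ^ N"
  shows "local_op N D A k $$ (x, y) =
    (if \<forall>i \<in> {..<N} - A. site D x i = site D y i
     then k (restrict (site D x) A) (restrict (site D y) A) else 0)"
  using assms by (simp add: local_op_def)

text \<open>Of the intermediate indices only \<open>z\<close> contributes: it must agree with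
  \<open>x\<close> off \<open>A\<close> and with \<open>y\<close> off \<open>B\<close>, so by
  disjointness it has the digits of \<open>y\<close> on \<open>A\<close> and of \<open>x\<close>
  elsewhere. The resulting entry is symmetric in the two factors, which gives commutation.\<close>

lemma local_op_mult_index:
  assumes D: "0 < D" and AB: "A \<subseteq> {..<N}" "B \<subseteq> {..<N}" "A \<inter> B = {}"
    and xy: "x < D ^ N" "y < D ^ N"
  shows "(local_op N D A k * local_op N D B l) $$ (x, y) =
    (if \<forall>i \<in> {..<N} - (A \<union> B). site D x i = site D y i
     then k (restrict (site D x) A) (restrict (site D y) A) *
       l (restrict (site D x) B) (restrict (site D y) B) else 0)"
proof -
  have "\<exists>z<D ^ N. \<forall>i<N. site D z i = (if i \<in> A then site D y i else site D x i)"
    by (rule site_exists) (simp add: site_less[OF D])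
  then obtain z where z: "z < D ^ N"
    "\<And>i. i < N \<Longrightarrow> site D z i = (if i \<in> A then site D y i else site D x i)"
    by blast
  have "local_op N D A k $$ (x, v) * local_op N D B l $$ (v, y) =
      (if v = z then local_op N D A k $$ (x, z) * local_op N D B l $$ (z, y) else 0)"
    if v: "v < D ^ N" for v
  proof (cases "(\<forall>i \<in> {..<N} - A. site D x i = site D v i) \<and> (\<forall>i \<in> {..<N} - B. site D v i = site D y i)")
    case True
    have "site D v i = site D z i" if "i < N" for i
      using True AB z(2)[OF that] that by (cases "i \<in> A") auto
    then have "v = z" using v z(1) by (intro site_inject[of v D N z])
    then show ?thesis by simp
  next
    case False
    then have "local_op N D A k $$ (x, v) * local_op N D B l $$ (v, y) = 0"
      using v xy by (auto simp: local_op_index)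
    then show ?thesis by auto
  qed
  then have "(\<Sum>v<D ^ N. local_op N D A k $$ (x, v) * local_op N D B l $$ (v, y)) =
      (\<Sum>v<D ^ N. if v = z then local_op N D A k $$ (x, z) * local_op N D B l $$ (z, y) else 0)"
    by (intro sum.cong refl) (simp only: lessThan_iff)
  then have "(local_op N D A k * local_op N D B l) $$ (x, y) =
      local_op N D A k $$ (x, z) * local_op N D B l $$ (z, y)"
    using xy z(1) by (subst mat_mult_index[of _ "D ^ N"]) simp_all
  moreover have "(\<forall>i \<in> {..<N} - A. site D x i = site D z i)"
    using z(2) by auto
  moreover have "(\<forall>i \<in> {..<N} - B. site D z i = site D y i) \<longleftrightarrow>
      (\<forall>i \<in> {..<N} - (A \<union> B). site D x i = site D y i)"
    using z(2) by auto
  moreover have "restrict (site D z) A = restrict (site D y) A"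
    using z(2) AB(1) by (intro restrict_ext) auto
  moreover have "restrict (site D z) B = restrict (site D x) B"
  proof (rule restrict_ext)
    fix i assume "i \<in> B"
    then have "i < N" "i \<notin> A" using AB by auto
    then show "site D z i = site D x i" using z(2) by simp
  qed
  ultimately show ?thesis using xy z(1) by (simp add: local_op_index)
qed

lemma local_op_commute:
  assumes "0 < D" "A \<subseteq> {..<N}" "B \<subseteq> {..<N}" "A \<inter> B = {}"
  shows "local_op N D A k * local_op N D B l = local_op N D B l * local_op N D A k"
proof (rule eq_matI)
  have dims: "dim_row (local_op N D A k) = D ^ N" "dim_col (local_op N D A k) = D ^ N"
    "dim_row (local_op N D B l) = D ^ N" "dim_col (local_op N D B l) = D ^ N"
    by (simp_all add: local_op_def)
  show "dim_row (local_op N D A k * local_op N D B l) = dim_row (local_op N D B l * local_op N D A k)"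
    "dim_col (local_op N D A k * local_op N D B l) = dim_col (local_op N D B l * local_op N D A k)"
    by (simp_all add: dims)
  fix x y assume "x < dim_row (local_op N D B l * local_op N D A k)"
    "y < dim_col (local_op N D B l * local_op N D A k)"
  then have xy: "x < D ^ N" "y < D ^ N" by (simp_all add: dims)
  have "B \<inter> A = {}" using assms(4) by blast
  then show "(local_op N D A k * local_op N D B l) $$ (x, y) = (local_op N D B l * local_op N D A k) $$ (x, y)"
    unfolding local_op_mult_index[OF assms xy] local_op_mult_index[OF assms(1,3,2) \<open>B \<inter> A = {}\<close> xy]
    by (simp add: Un_commute mult.commute)
qed

section \<open>Sums of one-site operators over a set of sites\<close>

lemma site_op_carrier [simp]: "site_op N D q j \<in> carrier_mat (D ^ N) (D ^ N)"
  by (simp add: site_op_def)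

lemma site_op_index:
  assumes "x < D ^ N" "y < D ^ N"
  shows "site_op N D q j $$ (x, y) =
    (if \<forall>i \<in> {..<N} - {j}. site D x i = site D y i then q $$ (site D x j, site D y j) else 0)"
  using assms by (simp add: site_op_def local_op_index)

lemma site_op_adjoint_index:
  assumes D: "0 < D" and q: "q \<in> carrier_mat D D" and xy: "x < D ^ N" "y < D ^ N"
  shows "site_op N D (mat_adjoint q) j $$ (x, y) = cnj (site_op N D q j $$ (y, x))"
  using q xy site_less[OF D] by (auto simp: site_op_index)

text \<open>Entrywise, so that the sum runs over a set of sites; splitting a total operator at the
  affected set is then additivity over disjoint unions.\<close>

definition partial_op :: "nat \<Rightarrow> nat \<Rightarrow> complex mat \<Rightarrow> nat set \<Rightarrow> complex mat" where
  "partial_op N D q S = mat (D ^ N) (D ^ N) (\<lambda>(x, y). \<Sum>j\<in>S. site_op N D q j $$ (x, y))"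

lemma partial_op_carrier [simp]: "partial_op N D q S \<in> carrier_mat (D ^ N) (D ^ N)"
  by (simp add: partial_op_def)

lemma partial_op_dim [simp]:
  "dim_row (partial_op N D q S) = D ^ N" "dim_col (partial_op N D q S) = D ^ N"
  by (simp_all add: partial_op_def)

lemma total_op_carrier [simp]: "total_op N D q \<in> carrier_mat (D ^ N) (D ^ N)"
  unfolding total_op_def by (rule mat_sum_carrier) auto

lemma total_op_conv_partial_op: "total_op N D q = partial_op N D q {..<N}"
proof (rule eq_matI)
  fix x y assume "x < dim_row (partial_op N D q {..<N})" "y < dim_col (partial_op N D q {..<N})"
  then have xy: "x < D ^ N" "y < D ^ N" by simp_all
  then show "total_op N D q $$ (x, y) = partial_op N D q {..<N} $$ (x, y)"
    unfolding total_op_def by (subst mat_sum_map_index) (auto simp: partial_op_def)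
qed (simp_all add: carrier_matD[OF total_op_carrier])

lemma partial_op_union:
  assumes "finite S" "finite T" "S \<inter> T = {}"
  shows "partial_op N D q (S \<union> T) = partial_op N D q S + partial_op N D q T"
  using assms by (intro eq_matI) (auto simp: partial_op_def sum.union_disjoint)

lemma partial_op_adjoint:
  assumes "0 < D" "q \<in> carrier_mat D D"
  shows "mat_adjoint (partial_op N D q S) = partial_op N D (mat_adjoint q) S"
  using assms by (intro eq_matI) (auto simp: partial_op_def site_op_adjoint_index)

lemma partial_op_commute:
  assumes M: "M \<in> carrier_mat (D ^ N) (D ^ N)"
    and comm: "\<And>j. j \<in> S \<Longrightarrow> M * site_op N D q j = site_op N D q j * M"
  shows "M * partial_op N D q S = partial_op N D q S * M"
proof (rule eq_matI)
  fix x y assume "x < dim_row (partial_op N D q S * M)" "y < dim_col (partial_op N D q S * M)"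
  then have xy: "x < D ^ N" "y < D ^ N" using M by simp_all
  have "(M * partial_op N D q S) $$ (x, y) = (\<Sum>k<D^N. \<Sum>j\<in>S. M $$ (x, k) * site_op N D q j $$ (k, y))"
    using M xy by (subst mat_mult_index[of _ "D ^ N"]) (simp_all add: partial_op_def sum_distrib_left)
  also have "\<dots> = (\<Sum>j\<in>S. (M * site_op N D q j) $$ (x, y))"
    using M xy by (subst sum.swap) (simp add: mat_mult_index[of _ "D ^ N"] del: index_mult_mat)
  also have "\<dots> = (\<Sum>j\<in>S. (site_op N D q j * M) $$ (x, y))"
    using comm by simp
  also have "\<dots> = (\<Sum>k<D^N. \<Sum>j\<in>S. site_op N D q j $$ (x, k) * M $$ (k, y))"
    using M xy by (subst sum.swap) (simp add: mat_mult_index[of _ "D ^ N"] del: index_mult_mat)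
  also have "\<dots> = (partial_op N D q S * M) $$ (x, y)"
    using M xy by (subst mat_mult_index[of _ "D ^ N"]) (simp_all add: partial_op_def sum_distrib_right)
  finally show "(M * partial_op N D q S) $$ (x, y) = (partial_op N D q S * M) $$ (x, y)" .
qed (use M in auto)

lemma local_op_partial_op_commute:
  assumes "0 < D" "A \<subseteq> {..<N}" "S \<subseteq> {..<N}" "A \<inter> S = {}"
  shows "local_op N D A k * partial_op N D q S = partial_op N D q S * local_op N D A k"
proof (rule partial_op_commute)
  fix j assume "j \<in> S"
  then show "local_op N D A k * site_op N D q j = site_op N D q j * local_op N D A k"
    unfolding site_op_def using assms by (intro local_op_commute) auto
qed simp

lemma partial_op_partial_op_commute:
  assumes "0 < D" "S \<subseteq> {..<N}" "T \<subseteq> {..<N}" "S \<inter> T = {}"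
  shows "partial_op N D p S * partial_op N D q T = partial_op N D q T * partial_op N D p S"
proof (rule partial_op_commute)
  fix j assume j: "j \<in> T"
  show "partial_op N D p S * site_op N D q j = site_op N D q j * partial_op N D p S"
    unfolding site_op_def using assms j by (intro local_op_partial_op_commute[symmetric]) auto
qed simp

section \<open>Norm bounds that do not grow with the dimension\<close>

lemma vnorm_mult_Schur_test:
  assumes A: "A \<in> carrier_mat n n" and v: "v \<in> carrier_vec n" and r: "0 \<le> r"
    and row: "\<And>x. x < n \<Longrightarrow> (\<Sum>y<n. cmod (A $$ (x, y))) \<le> r"
    and col: "\<And>y. y < n \<Longrightarrow> (\<Sum>x<n. cmod (A $$ (x, y))) \<le> r"
  shows "vnorm (A *\<^sub>v v) \<le> r * vnorm v"
proof -
  define a b where "a x y = cmod (A $$ (x, y))" and "b y = cmod (v $ y)" for x y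
  have a0: "a x y \<ge> 0" for x y by (simp add: a_def)
  have entry: "(cmod ((A *\<^sub>v v) $ x))\<^sup>2 \<le> r * (\<Sum>y<n. a x y * (b y)\<^sup>2)" if x: "x < n" for x
  proof -
    have "cmod ((A *\<^sub>v v) $ x) \<le> (\<Sum>y<n. a x y * b y)"
      unfolding mat_vec_index[OF A v x] a_def b_def
      by (rule order_trans[OF norm_sum]) (simp add: norm_mult)
    \<comment> \<open>Schur's splitting: each weight goes half into either factor of Cauchy-Schwarz.
      The first factor is controlled by the row sums, the second by the column sums once the order
      of summation is exchanged.\<close>
    then have "(cmod ((A *\<^sub>v v) $ x))\<^sup>2 \<le> (\<Sum>y<n. sqrt (a x y) * (sqrt (a x y) * b y))\<^sup>2"
      using a0 by (intro power_mono) (simp_all add: mult.assoc[symmetric])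
    also have "\<dots> \<le> (\<Sum>y<n. (sqrt (a x y))\<^sup>2) * (\<Sum>y<n. (sqrt (a x y) * b y)\<^sup>2)"
      by (rule Cauchy_Schwarz_ineq_sum)
    also have "\<dots> = (\<Sum>y<n. a x y) * (\<Sum>y<n. a x y * (b y)\<^sup>2)"
      using a0 by (simp add: power_mult_distrib)
    also have "\<dots> \<le> r * (\<Sum>y<n. a x y * (b y)\<^sup>2)"
      using row[OF x] a0 by (intro mult_right_mono sum_nonneg) (simp_all add: a_def)
    finally show ?thesis .
  qed
  have "(vnorm (A *\<^sub>v v))\<^sup>2 = (\<Sum>x<n. (cmod ((A *\<^sub>v v) $ x))\<^sup>2)"
    using A by (simp add: vnorm_def L2_set_def sum_nonneg del: index_mult_mat_vec)
  also have "\<dots> \<le> (\<Sum>x<n. r * (\<Sum>y<n. a x y * (b y)\<^sup>2))"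
    by (intro sum_mono entry) simp
  also have "\<dots> = r * (\<Sum>y<n. (\<Sum>x<n. a x y) * (b y)\<^sup>2)"
    unfolding sum_distrib_left[symmetric] by (subst sum.swap) (simp add: sum_distrib_right)
  also have "\<dots> \<le> r * (\<Sum>y<n. r * (b y)\<^sup>2)"
    using col r by (intro mult_left_mono sum_mono mult_right_mono) (simp_all add: a_def)
  also have "\<dots> = (r * vnorm v)\<^sup>2"
  proof -
    have "(vnorm v)\<^sup>2 = (\<Sum>y<n. (b y)\<^sup>2)"
      using v by (simp add: vnorm_def L2_set_def sum_nonneg b_def)
    then show ?thesis by (simp add: sum_distrib_left[symmetric] power_mult_distrib power2_eq_square[of r])
  qed
  finally show ?thesis using r by (simp add: power2_le_iff_abs_le)
qed

text \<open>A row or column is supported on indices that differ from a given one at most at site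
  \<open>j\<close>, so on at most \<open>D\<close> of them. The bound is thus free of
  \<open>D ^ N\<close>, and for a sum over sites only their number counts.\<close>

lemma vnorm_site_op:
  fixes r :: real
  assumes D: "0 < D" and q: "\<And>i j. i < D \<Longrightarrow> j < D \<Longrightarrow> cmod (q $$ (i, j)) \<le> r"
    and v: "v \<in> carrier_vec (D ^ N)"
  shows "vnorm (site_op N D q j *\<^sub>v v) \<le> D * r * vnorm v"
proof (rule vnorm_mult_Schur_test[OF site_op_carrier v])
  have r: "0 \<le> r" using order_trans[OF norm_ge_zero q[OF D D]] .
  then show "0 \<le> D * r" by simp
  define T where "T x = {y \<in> {..<D ^ N}. \<forall>i \<in> {..<N} - {j}. site D x i = site D y i}" for x
  have "inj_on (\<lambda>y. site D y j) (T x)" for x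
  proof (rule inj_onI)
    fix y y' assume y: "y \<in> T x" "y' \<in> T x" "site D y j = site D y' j"
    then have "site D y i = site D y' i" if "i < N" for i
      using that by (cases "i = j") (auto simp: T_def)
    then show "y = y'" using y by (intro site_inject[of y D N y']) (auto simp: T_def)
  qed
  then have "card (T x) \<le> card {..<D}" for x
    using site_less[OF D] by (intro card_inj_on_le[of "\<lambda>y. site D y j"]) auto
  then have card: "card (T x) \<le> D" for x by simp
  have sum_le: "(\<Sum>y<D ^ N. f y) \<le> D * r"
    if "\<And>y. y < D ^ N \<Longrightarrow> f y \<le> (if y \<in> T x then r else 0)" for f x
  proof -
    have "(\<Sum>y<D ^ N. f y) \<le> (\<Sum>y<D ^ N. if y \<in> T x then r else 0)"
      using that by (intro sum_mono) simp
    also have "\<dots> = card (T x) * r"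
      by (subst sum.inter_filter[symmetric]) (auto simp: T_def)
    also have "\<dots> \<le> D * r" using card r by (intro mult_right_mono) simp_all
    finally show ?thesis .
  qed
  show "(\<Sum>y<D ^ N. cmod (site_op N D q j $$ (x, y))) \<le> D * r" if "x < D ^ N" for x
    using that q site_less[OF D] by (intro sum_le[of _ x]) (auto simp: site_op_index T_def)
  show "(\<Sum>x<D ^ N. cmod (site_op N D q j $$ (x, y))) \<le> D * r" if "y < D ^ N" for y
    using that q site_less[OF D] by (intro sum_le[of _ y]) (auto simp: site_op_index T_def)
qed

lemma vnorm_partial_op:
  fixes r :: real
  assumes D: "0 < D" and q: "\<And>i j. i < D \<Longrightarrow> j < D \<Longrightarrow> cmod (q $$ (i, j)) \<le> r"
    and v: "v \<in> carrier_vec (D ^ N)" and S: "finite S"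
  shows "vnorm (partial_op N D q S *\<^sub>v v) \<le> card S * (D * r) * vnorm v"
  using S
proof (induction S rule: finite_induct)
  case empty
  have "partial_op N D q {} *\<^sub>v v = 0\<^sub>v (D ^ N)"
    using v by (intro eq_vecI) (auto simp: mat_vec_index[of _ "D ^ N"] partial_op_def
        simp del: index_mult_mat_vec)
  then show ?case by (simp add: vnorm_def L2_set_def)
next
  case (insert j S)
  have "partial_op N D q (insert j S) = site_op N D q j + partial_op N D q S"
    using insert.hyps carrier_matD[OF site_op_carrier[of N D q j]]
    by (intro eq_matI) (auto simp: partial_op_def)
  then have "vnorm (partial_op N D q (insert j S) *\<^sub>v v) \<le>
      vnorm (site_op N D q j *\<^sub>v v) + vnorm (partial_op N D q S *\<^sub>v v)"
    using v by (simp add: add_mult_distrib_mat_vec[of _ "D ^ N" "D ^ N"] vnorm_add[of _ "D ^ N"])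
  also have "\<dots> \<le> D * r * vnorm v + card S * (D * r) * vnorm v"
    using vnorm_site_op[OF D q v] insert.IH by (intro add_mono) auto
  finally show ?case using insert.hyps by (simp add: algebra_simps)
qed

section \<open>Powers of a truncated ladder operator\<close>

lemma pow_mat_carrier [simp]: "A \<in> carrier_mat n n \<Longrightarrow> A ^\<^sub>m k \<in> carrier_mat n n"
  by (rule pow_carrier_mat)

lemma pow_mat_commute:
  assumes "A \<in> carrier_mat n n" "B \<in> carrier_mat n n" "A * B = B * A"
  shows "A ^\<^sub>m k * B = B * A ^\<^sub>m k"
proof (induction k)
  case 0
  then show ?case using assms by simp
next
  case (Suc k)
  have "A ^\<^sub>m Suc k * B = A ^\<^sub>m k * (A * B)"
    using assms by (simp add: assoc_mult_mat[of _ n n _ n _ n])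
  also have "\<dots> = (A ^\<^sub>m k * B) * A"
    unfolding assms(3) using assms by (simp add: assoc_mult_mat[of _ n n _ n _ n])
  also have "\<dots> = B * A ^\<^sub>m Suc k"
    unfolding Suc using assms by (simp add: assoc_mult_mat[of _ n n _ n _ n])
  finally show ?case .
qed

lemma mat_adjoint_mult:
  fixes A B :: "complex mat"
  assumes "A \<in> carrier_mat n n" "B \<in> carrier_mat n n"
  shows "mat_adjoint (A * B) = mat_adjoint B * mat_adjoint A"
proof (rule eq_matI)
  fix i j assume "i < dim_row (mat_adjoint B * mat_adjoint A)" "j < dim_col (mat_adjoint B * mat_adjoint A)"
  then have ij: "i < n" "j < n" using assms by simp_all
  have "mat_adjoint (A * B) $$ (i, j) = cnj ((A * B) $$ (j, i))"
    using assms ij by (subst mat_adjoint_index) simp_all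
  also have "\<dots> = (mat_adjoint B * mat_adjoint A) $$ (i, j)"
    using assms ij by (simp add: mat_mult_index[of _ n] mult.commute del: index_mult_mat(1))
  finally show "mat_adjoint (A * B) $$ (i, j) = (mat_adjoint B * mat_adjoint A) $$ (i, j)" .
qed (use assms in auto)

lemma mat_adjoint_pow:
  fixes A :: "complex mat"
  assumes "A \<in> carrier_mat n n"
  shows "mat_adjoint (A ^\<^sub>m k) = mat_adjoint A ^\<^sub>m k"
proof (induction k)
  case 0
  have "mat_adjoint (1\<^sub>m n) = (1\<^sub>m n :: complex mat)" by (intro eq_matI) auto
  then show ?case using assms by simp
next
  case (Suc k)
  have "mat_adjoint (A ^\<^sub>m Suc k) = mat_adjoint A * mat_adjoint A ^\<^sub>m k"
    using assms Suc by (simp add: mat_adjoint_mult[of _ n])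
  also have "\<dots> = mat_adjoint A ^\<^sub>m Suc k"
    using assms pow_mat_commute[of "mat_adjoint A" n "mat_adjoint A" k] by simp
  finally show ?case .
qed

text \<open>One run of ladder steps: \<open>Qt\<close> is the full ladder operator with known action
  on the kets \<open>f i\<close>, \<open>L\<close> its small part on the affected sites,
  \<open>Qb\<close> the rest. Raising and lowering, from either probe ket, are all
  instances.\<close>

locale truncated_ladder =
  fixes n :: nat and Qb L Qt :: "complex mat" and q :: real
    and f :: "nat \<Rightarrow> complex vec" and c :: "nat \<Rightarrow> real" and K :: nat
  assumes Qb: "Qb \<in> carrier_mat n n" and L: "L \<in> carrier_mat n n"
    and Qt: "Qt = L + Qb" and comm: "L * Qb = Qb * L"
    and q: "0 \<le> q" "\<And>v. v \<in> carrier_vec n \<Longrightarrow> vnorm (L *\<^sub>v v) \<le> q * vnorm v"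
    and f: "\<And>i. i \<le> K \<Longrightarrow> f i \<in> carrier_vec n" "\<And>i. i \<le> K \<Longrightarrow> vnorm (f i) = 1"
    and step: "\<And>i. i < K \<Longrightarrow> Qt *\<^sub>v f i = complex_of_real (c i) \<cdot>\<^sub>v f (Suc i)"
    and c: "\<And>i. i < K \<Longrightarrow> 0 \<le> c i"
begin

definition C :: "nat \<Rightarrow> nat \<Rightarrow> real" where "C i k = (\<Prod>j<k. c (i + j))"

definition err :: "nat \<Rightarrow> nat \<Rightarrow> complex vec" where
  "err i k = Qb ^\<^sub>m k *\<^sub>v f i - complex_of_real (C i k) \<cdot>\<^sub>v f (i + k)"

lemma C_0 [simp]: "C i 0 = 1"
  by (simp add: C_def)

lemma C_Suc: "C i (Suc k) = c i * C (Suc i) k"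
  unfolding C_def by (subst prod.lessThan_Suc_shift) simp

lemma C_Suc_right: "C i (Suc k) = C i k * c (i + k)"
  by (simp add: C_def)

lemma C_nonneg: "i + k \<le> K \<Longrightarrow> 0 \<le> C i k"
  unfolding C_def using c by (intro prod_nonneg) auto

lemma err_0: "vnorm (err i 0) = 0" if "i \<le> K"
proof -
  have "err i 0 = 0\<^sub>v n" using f(1)[OF that] Qb by (auto simp: err_def)
  then show ?thesis by (simp add: vnorm_def L2_set_def)
qed

lemma pow_conv_err:
  assumes "i + k \<le> K"
  shows "Qb ^\<^sub>m k *\<^sub>v f i = err i k + complex_of_real (C i k) \<cdot>\<^sub>v f (i + k)"
  using f(1)[of i] f(1)[OF assms] assms carrier_matD[OF pow_mat_carrier[OF Qb, of k]]
  by (intro eq_vecI) (auto simp: err_def)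

lemma err_carrier: "i + k \<le> K \<Longrightarrow> err i k \<in> carrier_vec n"
  using f(1)[of i] f(1)[of "i + k"] Qb by (auto simp: err_def)

lemma vnorm_pow_le: "vnorm (Qb ^\<^sub>m k *\<^sub>v f i) \<le> vnorm (err i k) + C i k" if "i + k \<le> K"
  unfolding pow_conv_err[OF that]
  using vnorm_add[OF err_carrier[OF that], of "complex_of_real (C i k) \<cdot>\<^sub>v f (i + k)"]
    f[OF that] C_nonneg[OF that] by (simp add: vnorm_smult)

text \<open>Since \<open>L\<close> and \<open>Qb\<close> commute, \<open>Qb ^ (k + 1) f\<^sub>i = c\<^sub>i Qb ^ k f\<^sub>i\<^sub>+\<^sub>1 - L Qb ^ k f\<^sub>i\<close>; keeping \<open>L\<close>
  on the left means that only its small norm enters, never the large norm of \<open>Qb\<close>.\<close>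

lemma err_Suc:
  assumes "i + Suc k \<le> K"
  shows "vnorm (err i (Suc k)) \<le> c i * vnorm (err (Suc i) k) + q * vnorm (Qb ^\<^sub>m k *\<^sub>v f i)"
proof -
  have i: "i < K" "i \<le> K" "Suc i \<le> K" "Suc i + k \<le> K" using assms by auto
  note fi = f(1)[OF i(2)] and fs = f(1)[OF i(3)] and fk = f(1)[OF i(4)]
  have P: "Qb ^\<^sub>m k \<in> carrier_mat n n" using Qb by simp
  have comm': "Qb ^\<^sub>m k *\<^sub>v (L *\<^sub>v f i) = L *\<^sub>v (Qb ^\<^sub>m k *\<^sub>v f i)"
    using pow_mat_commute[OF Qb L comm[symmetric], of k] fi L P
      assoc_mult_mat_vec[of "Qb ^\<^sub>m k" n n L n "f i"] assoc_mult_mat_vec[of L n n "Qb ^\<^sub>m k" n "f i"]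
    by simp
  have "complex_of_real (c i) \<cdot>\<^sub>v f (Suc i) = L *\<^sub>v f i + Qb *\<^sub>v f i"
    using step[OF i(1)] L Qb fi by (simp add: Qt add_mult_distrib_mat_vec[of _ n n])
  then have "Qb *\<^sub>v f i = complex_of_real (c i) \<cdot>\<^sub>v f (Suc i) - L *\<^sub>v f i"
    using L Qb fi by (intro eq_vecI) auto
  then have "Qb ^\<^sub>m Suc k *\<^sub>v f i = Qb ^\<^sub>m k *\<^sub>v (complex_of_real (c i) \<cdot>\<^sub>v f (Suc i) - L *\<^sub>v f i)"
    using P Qb fi by (simp add: assoc_mult_mat_vec[of _ n n _ n])
  also have "\<dots> = complex_of_real (c i) \<cdot>\<^sub>v (Qb ^\<^sub>m k *\<^sub>v f (Suc i)) - L *\<^sub>v (Qb ^\<^sub>m k *\<^sub>v f i)"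
    unfolding comm'[symmetric] using P L fi fs
    by (simp add: mult_minus_distrib_mat_vec[of _ n n] mult_mat_vec[of _ n n])
  finally have "err i (Suc k) = complex_of_real (c i) \<cdot>\<^sub>v err (Suc i) k - L *\<^sub>v (Qb ^\<^sub>m k *\<^sub>v f i)"
    using L P fi fs fk carrier_matD[OF L] carrier_matD[OF P]
    by (intro eq_vecI) (auto simp: err_def C_Suc algebra_simps simp del: index_mult_mat_vec)
  then have "vnorm (err i (Suc k)) \<le>
      vnorm (complex_of_real (c i) \<cdot>\<^sub>v err (Suc i) k) + vnorm (L *\<^sub>v (Qb ^\<^sub>m k *\<^sub>v f i))"
    using L P fi err_carrier[OF i(4)] by (simp add: vnorm_diff[of _ n])
  also have "\<dots> \<le> c i * vnorm (err (Suc i) k) + q * vnorm (Qb ^\<^sub>m k *\<^sub>v f i)"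
    using q(2)[of "Qb ^\<^sub>m k *\<^sub>v f i"] P fi c[OF i(1)] by (simp add: vnorm_smult)
  finally show ?thesis .
qed

lemma C_le:
  assumes "\<And>i. i < K \<Longrightarrow> c i \<le> g" "i + k \<le> K"
  shows "C i k \<le> g ^ k"
proof -
  have "C i k \<le> (\<Prod>j<k. g)"
    unfolding C_def using assms c by (intro prod_mono) auto
  then show ?thesis by simp
qed

lemma C_ge:
  assumes "\<And>i. i < K \<Longrightarrow> g \<le> c i" "0 \<le> g" "i + k \<le> K"
  shows "g ^ k \<le> C i k"
proof -
  have "(\<Prod>j<k. g) \<le> C i k"
    unfolding C_def using assms by (intro prod_mono) auto
  then show ?thesis by simp
qed

text \<open>The recursion becomes e -> g e + q (e + g^k), solved by a binomial remainder. The bound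
  is absolute, for runs whose coefficients may get too small for a relative one.\<close>

lemma err_le_of_coeff_le:
  assumes g: "\<And>i. i < K \<Longrightarrow> c i \<le> g" "0 \<le> g" and "i + k \<le> K"
  shows "vnorm (err i k) \<le> (g + q) ^ k - g ^ k"
  using assms(3)
proof (induction k arbitrary: i)
  case 0
  then show ?case by (simp add: err_0)
next
  case (Suc k)
  have "vnorm (err i (Suc k)) \<le> c i * vnorm (err (Suc i) k) + q * vnorm (Qb ^\<^sub>m k *\<^sub>v f i)"
    using Suc.prems by (rule err_Suc)
  also have "q * vnorm (Qb ^\<^sub>m k *\<^sub>v f i) \<le> q * (g + q) ^ k"
    using Suc.IH[of i] vnorm_pow_le[of i k] C_le[OF g(1), of i k] Suc.prems q(1)
    by (intro mult_left_mono) auto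
  also have "c i * vnorm (err (Suc i) k) \<le> g * ((g + q) ^ k - g ^ k)"
    using Suc.IH[of "Suc i"] Suc.prems g c by (intro mult_mono) auto
  finally show ?case by (simp add: algebra_simps)
qed

text \<open>Relative counterpart for coefficients bounded below: each factor \<open>q\<close> costs
  at most \<open>q / g\<close> times the coefficient that it replaces.\<close>

lemma err_le_of_coeff_ge:
  assumes g: "\<And>i. i < K \<Longrightarrow> g \<le> c i" "0 < g" and "i + k \<le> K"
  shows "vnorm (err i k) \<le> C i k * ((1 + q / g) ^ k - 1)"
  using assms(3)
proof (induction k arbitrary: i)
  case 0
  then show ?case by (simp add: err_0)
next
  case (Suc k)
  define t where "t = q / g"
  have t: "0 \<le> t" using q(1) g(2) by (simp add: t_def)
  have "vnorm (err i (Suc k)) \<le> c i * vnorm (err (Suc i) k) + q * vnorm (Qb ^\<^sub>m k *\<^sub>v f i)"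
    using Suc.prems by (rule err_Suc)
  also have "c i * vnorm (err (Suc i) k) \<le> c i * (C (Suc i) k * ((1 + t) ^ k - 1))"
    using Suc.IH[of "Suc i", folded t_def] Suc.prems c by (intro mult_left_mono) auto
  also have "\<dots> = C i (Suc k) * ((1 + t) ^ k - 1)" by (simp add: C_Suc)
  also have "q * vnorm (Qb ^\<^sub>m k *\<^sub>v f i) \<le> C i (Suc k) * (t * (1 + t) ^ k)"
  proof -
    have "vnorm (Qb ^\<^sub>m k *\<^sub>v f i) \<le> C i k * (1 + t) ^ k"
      using Suc.IH[of i, folded t_def] vnorm_pow_le[of i k] Suc.prems by (simp add: right_diff_distrib)
    then have "q * vnorm (Qb ^\<^sub>m k *\<^sub>v f i) \<le> t * g * (C i k * (1 + t) ^ k)"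
      using q(1) g(2) mult_left_mono[of _ "C i k * (1 + t) ^ k" q] by (simp add: t_def)
    \<comment> \<open>Here \<open>g\<close> is absorbed by the last coefficient
      \<open>c (i + k)\<close>, whereas the other summand picks up the first one,
      \<open>c i\<close>; both products complete to \<open>C i (Suc k)\<close>.\<close>
    also have "\<dots> \<le> t * c (i + k) * (C i k * (1 + t) ^ k)"
      using g(1)[of "i + k"] t Suc.prems C_nonneg[of i k]
      by (intro mult_right_mono mult_left_mono) auto
    finally show ?thesis by (simp add: C_Suc_right mult_ac)
  qed
  finally show ?case unfolding t_def[symmetric] by (simp add: algebra_simps)
qed

end

section \<open>Ladder coefficients and the transfer between the probe kets\<close>

lemma smult_diff_smult:
  fixes a b :: "complex vec"
  assumes "a \<in> carrier_vec n" "b \<in> carrier_vec n" "p \<noteq> 0"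
  shows "(1 / p) \<cdot>\<^sub>v a - k \<cdot>\<^sub>v b = (1 / p) \<cdot>\<^sub>v (a - (p * k) \<cdot>\<^sub>v b)"
  using assms by (intro eq_vecI) (auto simp: field_simps)

definition lower_coeff :: "real \<Rightarrow> real \<Rightarrow> real" where
  "lower_coeff J m = sqrt ((J + m) * (J - m + 1))"

text \<open>The radicand equals (J + 1/2)^2 - (m - 1/2)^2: the step from m to m - 1 has midpoint m -
  1/2, and coefficients decrease with its distance from 0.\<close>

lemma lower_coeff_mono:
  assumes "\<bar>m - 1/2\<bar> \<le> \<bar>m' - 1/2\<bar>"
  shows "lower_coeff J m' \<le> lower_coeff J m"
proof -
  have "(m - 1/2)\<^sup>2 \<le> (m' - 1/2)\<^sup>2" using assms by (simp add: abs_le_square_iff)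
  then show ?thesis unfolding lower_coeff_def
    by (intro real_sqrt_le_mono) (simp add: power2_eq_square algebra_simps)
qed

text \<open>The coefficient at \<open>M\<close> separates the two runs of \<open>K\<close> steps:
  those from \<open>M\<close> to \<open>- M\<close> have coefficients at least as large, those from
  \<open>- M\<close> to \<open>- (3 * M)\<close> at most as large. So the first run takes the
  relative error bound and the second the absolute one; since the K-th power of that coefficient is
  at most \<open>P\<close>, both errors end up below \<open>t\<close>. The same comparison gives
  \<open>\<kappa> \<le> 1\<close>.\<close>

lemma ladder_transfer:
  fixes \<phi> :: "real \<Rightarrow> complex vec"
  assumes ops: "Qb \<in> carrier_mat n n" "L \<in> carrier_mat n n" "Qt = L + Qb" "L * Qb = Qb * L"
    and q: "0 \<le> q" "\<And>v. v \<in> carrier_vec n \<Longrightarrow> vnorm (L *\<^sub>v v) \<le> q * vnorm v"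
    and M: "real K = 2 * M" "0 < M" "3 * M \<le> J"
    and \<phi>: "\<And>i. i \<le> 2 * K \<Longrightarrow> \<phi> (M - real i) \<in> carrier_vec n \<and> vnorm (\<phi> (M - real i)) = 1"
    and step: "\<And>i. i < 2 * K \<Longrightarrow>
      Qt *\<^sub>v \<phi> (M - real i) = complex_of_real (lower_coeff J (M - real i)) \<cdot>\<^sub>v \<phi> (M - real i - 1)"
  defines "P \<equiv> (\<Prod>i<K. lower_coeff J (M - real i))"
    and "\<kappa> \<equiv> (\<Prod>i<K. lower_coeff J (- M - real i)) / (\<Prod>i<K. lower_coeff J (M - real i))"
    and "t \<equiv> (1 + q / lower_coeff J M) ^ K - 1"
  shows "0 < P" "0 \<le> \<kappa>" "\<kappa> \<le> 1"
    "vnorm (complex_of_real (1 / P) \<cdot>\<^sub>v (Qb ^\<^sub>m K *\<^sub>v \<phi> M) - \<phi> (- M)) \<le> t"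
    "vnorm (complex_of_real (1 / P) \<cdot>\<^sub>v (Qb ^\<^sub>m K *\<^sub>v \<phi> (- M)) - complex_of_real \<kappa> \<cdot>\<^sub>v \<phi> (- (3 * M))) \<le> t"
proof -
  define g where "g = lower_coeff J M"
  have g: "0 < g" using M by (simp add: g_def lower_coeff_def)
  have nonneg: "0 \<le> lower_coeff J m" if "- J \<le> m" "m \<le> J + 1" for m
    using that by (simp add: lower_coeff_def)
  have iM: "- M < M - real i" "\<bar>M - real i - 1/2\<bar> \<le> \<bar>M - 1/2\<bar>" if "i < K" for i
  proof -
    have "real i + 1 \<le> 2 * M" using that M by (metis Suc_eq_plus1 Suc_leI of_nat_Suc of_nat_le_iff add.commute)
    then show "- M < M - real i" "\<bar>M - real i - 1/2\<bar> \<le> \<bar>M - 1/2\<bar>" by auto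
  qed
  \<comment> \<open>The second run continues the first one: it starts at index
    \<open>K\<close>.\<close>
  have e: "M - real (K + i) = - M - real i" for i using M by simp
  interpret A: truncated_ladder n Qb L Qt q "\<lambda>i. \<phi> (M - real i)" "\<lambda>i. lower_coeff J (M - real i)" K
  proof
    show "Qt *\<^sub>v \<phi> (M - real i) = complex_of_real (lower_coeff J (M - real i)) \<cdot>\<^sub>v \<phi> (M - real (Suc i))"
      if "i < K" for i
      using step[of i] that by (simp add: algebra_simps)
    show "0 \<le> lower_coeff J (M - real i)" if "i < K" for i
      using iM[OF that] M by (intro nonneg) auto
  qed (use ops q \<phi> in auto)
  interpret B: truncated_ladder n Qb L Qt q "\<lambda>i. \<phi> (- M - real i)" "\<lambda>i. lower_coeff J (- M - real i)" K
  proof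
    show "Qt *\<^sub>v \<phi> (- M - real i) = complex_of_real (lower_coeff J (- M - real i)) \<cdot>\<^sub>v \<phi> (- M - real (Suc i))"
      if "i < K" for i
      using step[of "K + i"] that unfolding e by (simp add: algebra_simps)
    show "0 \<le> lower_coeff J (- M - real i)" if "i < K" for i
      using iM[OF that] M by (intro nonneg) auto
    show "\<phi> (- M - real i) \<in> carrier_vec n" "vnorm (\<phi> (- M - real i)) = 1" if "i \<le> K" for i
      using \<phi>[of "K + i"] that unfolding e by auto
  qed (use ops q in auto)
  have gA: "g \<le> lower_coeff J (M - real i)" if "i < K" for i
    unfolding g_def using iM(2)[OF that] by (rule lower_coeff_mono)
  have gB: "lower_coeff J (- M - real i) \<le> g" if "i < K" for i
    unfolding g_def using M by (intro lower_coeff_mono) auto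
  have P: "P = A.C 0 K" by (simp add: P_def A.C_def)
  have gP: "g ^ K \<le> P" unfolding P using gA g by (intro A.C_ge) auto
  show P0: "0 < P" using gP g by (meson less_le_trans zero_less_power)
  have \<kappa>: "\<kappa> = B.C 0 K / P" by (simp add: \<kappa>_def P_def B.C_def)
  have CB: "B.C 0 K \<le> g ^ K" using gB by (intro B.C_le) auto
  show "0 \<le> \<kappa>" using P0 B.C_nonneg[of 0 K] by (simp add: \<kappa>)
  show "\<kappa> \<le> 1" using P0 CB gP by (simp add: \<kappa>)
  have tP: "(g + q) ^ K - g ^ K \<le> P * t"
  proof -
    have "g + q = g * (1 + q / g)" using g by (simp add: field_simps)
    then have "(g + q) ^ K = g ^ K * (1 + q / g) ^ K" by (simp only: power_mult_distrib)
    then have "(g + q) ^ K - g ^ K = g ^ K * t"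
      by (simp add: t_def g_def[symmetric] right_diff_distrib)
    moreover have "0 \<le> t" using g q(1) by (simp add: t_def g_def[symmetric] one_le_power)
    ultimately show ?thesis using gP by (simp add: mult_right_mono)
  qed
  have mM: "M - real K = - M" "- M - real K = - (3 * M)" using M by simp_all
  have pow: "Qb ^\<^sub>m K \<in> carrier_mat n n" using ops(1) by simp
  have \<phi>c: "\<phi> M \<in> carrier_vec n" "\<phi> (- M) \<in> carrier_vec n" "\<phi> (- (3 * M)) \<in> carrier_vec n"
    using A.f(1)[of 0] A.f(1)[of K] B.f(1)[of K] unfolding mM by simp_all
  have "A.err 0 K = Qb ^\<^sub>m K *\<^sub>v \<phi> M - complex_of_real P \<cdot>\<^sub>v \<phi> (- M)"
    unfolding A.err_def P add_0 mM by simp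
  then have "complex_of_real (1 / P) \<cdot>\<^sub>v (Qb ^\<^sub>m K *\<^sub>v \<phi> M) - \<phi> (- M) =
      complex_of_real (1 / P) \<cdot>\<^sub>v A.err 0 K"
    using P0 smult_diff_smult[OF square_mult_vec_carrier[OF pow \<phi>c(1)] \<phi>c(2), of "complex_of_real P" 1]
    by simp
  moreover have "vnorm (A.err 0 K) \<le> P * t"
    using A.err_le_of_coeff_ge[of g 0 K] gA g by (simp add: P t_def g_def)
  ultimately show "vnorm (complex_of_real (1 / P) \<cdot>\<^sub>v (Qb ^\<^sub>m K *\<^sub>v \<phi> M) - \<phi> (- M)) \<le> t"
    using P0 by (simp add: vnorm_smult norm_divide field_simps)
  have "complex_of_real (1 / P) \<cdot>\<^sub>v (Qb ^\<^sub>m K *\<^sub>v \<phi> (- M)) - complex_of_real \<kappa> \<cdot>\<^sub>v \<phi> (- (3 * M)) =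
      complex_of_real (1 / P) \<cdot>\<^sub>v B.err 0 K"
  proof -
    have "B.err 0 K = Qb ^\<^sub>m K *\<^sub>v \<phi> (- M) - complex_of_real (P * \<kappa>) \<cdot>\<^sub>v \<phi> (- (3 * M))"
      unfolding B.err_def add_0 mM using P0 by (simp add: \<kappa>)
    then show ?thesis
      using P0 smult_diff_smult[OF square_mult_vec_carrier[OF pow \<phi>c(2)] \<phi>c(3),
          of "complex_of_real P" "complex_of_real \<kappa>"]
      by simp
  qed
  moreover have "vnorm (B.err 0 K) \<le> P * t"
    using B.err_le_of_coeff_le[of g 0 K] gB g tP by simp
  ultimately show "vnorm (complex_of_real (1 / P) \<cdot>\<^sub>v (Qb ^\<^sub>m K *\<^sub>v \<phi> (- M)) -
      complex_of_real \<kappa> \<cdot>\<^sub>v \<phi> (- (3 * M))) \<le> t"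
    using P0 by (simp add: vnorm_smult norm_divide field_simps)
qed

section \<open>Kraus operators acting on the probe state\<close>

definition rank_one :: "nat \<Rightarrow> complex vec \<Rightarrow> complex vec \<Rightarrow> complex mat" where
  "rank_one n a b = mat n n (\<lambda>(x, y). a $ x * cnj (b $ y))"

lemma rank_one_carrier [simp]: "rank_one n a b \<in> carrier_mat n n"
  by (simp add: rank_one_def)

lemma rank_one_dim [simp]: "dim_row (rank_one n a b) = n" "dim_col (rank_one n a b) = n"
  by (simp_all add: rank_one_def)

lemma rank_one_index: "x < n \<Longrightarrow> y < n \<Longrightarrow> rank_one n a b $$ (x, y) = a $ x * cnj (b $ y)"
  by (simp add: rank_one_def)

lemma ket_bra_conv_rank_one: "v \<in> carrier_vec n \<Longrightarrow> ket_bra v = rank_one n v v"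
  by (simp add: ket_bra_def rank_one_def)

lemma mult_rank_one:
  assumes "K \<in> carrier_mat n n" "a \<in> carrier_vec n"
  shows "K * rank_one n a b = rank_one n (K *\<^sub>v a) b"
proof (rule eq_matI)
  fix x y assume "x < dim_row (rank_one n (K *\<^sub>v a) b)" "y < dim_col (rank_one n (K *\<^sub>v a) b)"
  then show "(K * rank_one n a b) $$ (x, y) = rank_one n (K *\<^sub>v a) b $$ (x, y)"
    using assms by (simp add: mat_mult_index[of _ n] mat_vec_index[of _ n] rank_one_index
        sum_distrib_right mult.assoc del: index_mult_mat(1) index_mult_mat_vec)
qed (use assms in simp_all)

lemma rank_one_mult_adjoint:
  assumes "K \<in> carrier_mat n n" "b \<in> carrier_vec n"
  shows "rank_one n a b * mat_adjoint K = rank_one n a (K *\<^sub>v b)"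
proof (rule eq_matI)
  fix x y assume "x < dim_row (rank_one n a (K *\<^sub>v b))" "y < dim_col (rank_one n a (K *\<^sub>v b))"
  then show "(rank_one n a b * mat_adjoint K) $$ (x, y) = rank_one n a (K *\<^sub>v b) $$ (x, y)"
    using assms carrier_matD[OF assms(1)]
    by (simp add: mat_mult_index[of _ n] mat_vec_index[of _ n] rank_one_index
        sum_distrib_left mult_ac del: index_mult_mat(1) index_mult_mat_vec)
qed (use assms in simp_all)

text \<open>Brings the derivative of the probe into product-rule form, with velocity -i Q v, as
  \<open>outer_sum_derivative\<close> expects.\<close>

lemma hermitian_commutator_rank_one:
  assumes Q: "Q \<in> carrier_mat n n" "hermitian Q" and v: "v \<in> carrier_vec n"
  shows "(- \<i>) \<cdot>\<^sub>m commutator Q (rank_one n v v) =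
    rank_one n ((- \<i>) \<cdot>\<^sub>v (Q *\<^sub>v v)) v + rank_one n v ((- \<i>) \<cdot>\<^sub>v (Q *\<^sub>v v))"
proof -
  have "rank_one n v v * Q = rank_one n v (Q *\<^sub>v v)"
    using rank_one_mult_adjoint[OF Q(1) v] Q(2) by (simp add: hermitian_def)
  then show ?thesis unfolding commutator_def mult_rank_one[OF Q(1) v]
    using Q v by (intro eq_matI) (auto simp: rank_one_index algebra_simps simp del: index_mult_mat_vec)
qed

text \<open>Padding by zero makes the family total in \<open>j\<close>, since
  \<open>outer_sum_derivative\<close> asks for vectors of the right dimension at every
  index.\<close>

definition kraus :: "nat \<Rightarrow> complex mat list \<Rightarrow> nat \<Rightarrow> complex mat" where
  "kraus n Ks j = (if j < length Ks then Ks ! j else 0\<^sub>m n n)"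

lemma kraus_carrier [simp]: "set Ks \<subseteq> carrier_mat n n \<Longrightarrow> kraus n Ks j \<in> carrier_mat n n"
  by (auto simp: kraus_def)

lemma apply_channel_carrier:
  "set Ks \<subseteq> carrier_mat n n \<Longrightarrow> \<rho> \<in> carrier_mat n n \<Longrightarrow> apply_channel n Ks \<rho> \<in> carrier_mat n n"
  unfolding apply_channel_def by (rule mat_sum_carrier) auto

lemma apply_channel_rank_one:
  assumes Ks: "set Ks \<subseteq> carrier_mat n n" and ab: "a \<in> carrier_vec n" "b \<in> carrier_vec n"
  shows "apply_channel n Ks (rank_one n a b) =
    outer_sum n (length Ks) (\<lambda>j. kraus n Ks j *\<^sub>v a) (\<lambda>j. kraus n Ks j *\<^sub>v b)"
proof (rule eq_matI)
  let ?O = "outer_sum n (length Ks) (\<lambda>j. kraus n Ks j *\<^sub>v a) (\<lambda>j. kraus n Ks j *\<^sub>v b)"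
  show "dim_row (apply_channel n Ks (rank_one n a b)) = dim_row ?O"
    "dim_col (apply_channel n Ks (rank_one n a b)) = dim_col ?O"
    using carrier_matD[OF apply_channel_carrier[OF Ks rank_one_carrier[of n a b]]]
    by (simp_all add: outer_sum_def)
  fix x y assume "x < dim_row ?O" "y < dim_col ?O"
  then have xy: "x < n" "y < n" by (simp_all add: outer_sum_def)
  have K: "K * rank_one n a b * mat_adjoint K = rank_one n (K *\<^sub>v a) (K *\<^sub>v b)" if "K \<in> set Ks" for K
    using that Ks ab by (auto simp: mult_rank_one rank_one_mult_adjoint)
  have "apply_channel n Ks (rank_one n a b) $$ (x, y) =
      (\<Sum>j<length Ks. (Ks ! j * rank_one n a b * mat_adjoint (Ks ! j)) $$ (x, y))"
    unfolding apply_channel_def using Ks xy by (subst mat_sum_map_index) auto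
  also have "\<dots> = ?O $$ (x, y)"
    using xy by (auto simp: K outer_sum_def rank_one_index kraus_def simp del: index_mult_mat_vec
        intro!: sum.cong)
  finally show "apply_channel n Ks (rank_one n a b) $$ (x, y) = ?O $$ (x, y)" .
qed

lemma apply_channel_add:
  assumes Ks: "set Ks \<subseteq> carrier_mat n n" and ab: "R \<in> carrier_mat n n" "S \<in> carrier_mat n n"
  shows "apply_channel n Ks (R + S) = apply_channel n Ks R + apply_channel n Ks S"
proof (rule eq_matI)
  note c = apply_channel_carrier[OF Ks ab(1)] apply_channel_carrier[OF Ks ab(2)]
    apply_channel_carrier[OF Ks add_carrier_mat[OF ab(2), of R]]
  note d = c[THEN carrier_matD(1)] c[THEN carrier_matD(2)]
  show "dim_row (apply_channel n Ks (R + S)) = dim_row (apply_channel n Ks R + apply_channel n Ks S)"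
    "dim_col (apply_channel n Ks (R + S)) = dim_col (apply_channel n Ks R + apply_channel n Ks S)"
    by (simp_all add: d)
  fix x y assume "x < dim_row (apply_channel n Ks R + apply_channel n Ks S)"
    "y < dim_col (apply_channel n Ks R + apply_channel n Ks S)"
  then have xy: "x < n" "y < n" by (simp_all add: d)
  have K: "K * (R + S) * mat_adjoint K = K * R * mat_adjoint K + K * S * mat_adjoint K"
    if "K \<in> set Ks" for K
  proof -
    have k: "K \<in> carrier_mat n n" "mat_adjoint K \<in> carrier_mat n n" using that Ks by auto
    show ?thesis using ab k
      by (simp add: mult_add_distrib_mat[of _ n n] add_mult_distrib_mat[OF _ _ k(2), of _ n])
  qed
  have e: "apply_channel n Ks T $$ (x, y) = (\<Sum>j<length Ks. (Ks ! j * T * mat_adjoint (Ks ! j)) $$ (x, y))"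
    if "T \<in> carrier_mat n n" for T
    unfolding apply_channel_def using Ks xy that by (subst mat_sum_map_index) auto
  have "apply_channel n Ks (R + S) $$ (x, y) =
      (\<Sum>j<length Ks. (Ks ! j * R * mat_adjoint (Ks ! j)) $$ (x, y) +
        (Ks ! j * S * mat_adjoint (Ks ! j)) $$ (x, y))"
    unfolding e[OF add_carrier_mat[OF ab(2), of R]]
  proof (intro sum.cong refl)
    fix j assume "j \<in> {..<length Ks}"
    then have j: "Ks ! j \<in> set Ks" by simp
    then have "Ks ! j \<in> carrier_mat n n" using Ks by auto
    then show "(Ks ! j * (R + S) * mat_adjoint (Ks ! j)) $$ (x, y) =
      (Ks ! j * R * mat_adjoint (Ks ! j)) $$ (x, y) + (Ks ! j * S * mat_adjoint (Ks ! j)) $$ (x, y)"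
      unfolding K[OF j] using xy ab by (subst index_add_mat) auto
  qed
  also have "\<dots> = (apply_channel n Ks R + apply_channel n Ks S) $$ (x, y)"
    using xy by (subst index_add_mat) (simp_all add: d e[OF ab(1)] e[OF ab(2)] sum.distrib)
  finally show "apply_channel n Ks (R + S) $$ (x, y) =
    (apply_channel n Ks R + apply_channel n Ks S) $$ (x, y)" .
qed

text \<open>Completeness of the Kraus operators in polarised form. It removes the channel from the
  sums in both bounds.\<close>

lemma kraus_sum_inner:
  assumes Ks: "set Ks \<subseteq> carrier_mat n n"
    and one: "mat_sum n (map (\<lambda>K. mat_adjoint K * K) Ks) = 1\<^sub>m n"
    and ab: "a \<in> carrier_vec n" "b \<in> carrier_vec n"
  shows "(\<Sum>j<length Ks. (kraus n Ks j *\<^sub>v a) \<bullet>c (kraus n Ks j *\<^sub>v b)) = a \<bullet>c b"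
proof -
  define G where "G j = mat_adjoint (kraus n Ks j) * kraus n Ks j" for j
  have kc: "kraus n Ks j \<in> carrier_mat n n" "mat_adjoint (kraus n Ks j) \<in> carrier_mat n n" for j
    using Ks by simp_all
  have G: "G j \<in> carrier_mat n n" for j unfolding G_def using kc by simp
  have sumG: "(\<Sum>j<length Ks. G j $$ (x, y)) = (if x = y then 1 else 0)" if "x < n" "y < n" for x y
  proof -
    have "(\<Sum>j<length Ks. G j $$ (x, y)) = (\<Sum>j<length Ks. (mat_adjoint (Ks ! j) * Ks ! j) $$ (x, y))"
      by (rule sum.cong) (simp_all add: G_def kraus_def)
    also have "\<dots> = mat_sum n (map (\<lambda>K. mat_adjoint K * K) Ks) $$ (x, y)"
      using Ks that by (subst mat_sum_map_index) auto
    finally show ?thesis using that by (simp add: one)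
  qed
  have "(\<Sum>j<length Ks. (kraus n Ks j *\<^sub>v a) \<bullet>c (kraus n Ks j *\<^sub>v b)) =
      (\<Sum>j<length Ks. cnj (b \<bullet>c (G j *\<^sub>v a)))"
  proof (intro sum.cong refl)
    fix j
    have "(kraus n Ks j *\<^sub>v b) \<bullet>c (kraus n Ks j *\<^sub>v a) = b \<bullet>c (G j *\<^sub>v a)"
      using inner_mat_adjoint[OF kc(1)[of j] ab(2), of "kraus n Ks j *\<^sub>v a"] kc ab
      by (simp add: G_def assoc_mult_mat_vec[of _ n n _ n])
    then show "(kraus n Ks j *\<^sub>v a) \<bullet>c (kraus n Ks j *\<^sub>v b) = cnj (b \<bullet>c (G j *\<^sub>v a))"
      using inner_commute[of "kraus n Ks j *\<^sub>v b" n "kraus n Ks j *\<^sub>v a"] kc ab by simp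
  qed
  also have "\<dots> = (\<Sum>j<length Ks. \<Sum>x<n. \<Sum>y<n. G j $$ (x, y) * a $ y * cnj (b $ x))"
    using G ab by (auto simp: inner_conv_sum[of _ n] mat_vec_index[of _ n] sum_distrib_left mult_ac
        simp del: index_mult_mat_vec intro!: sum.cong)
  also have "\<dots> = (\<Sum>x<n. \<Sum>y<n. \<Sum>j<length Ks. G j $$ (x, y) * a $ y * cnj (b $ x))"
    by (subst sum.swap, rule sum.cong[OF refl], rule sum.swap)
  also have "\<dots> = (\<Sum>x<n. \<Sum>y<n. (if x = y then 1 else 0) * a $ y * cnj (b $ x))"
    by (intro sum.cong refl) (simp add: sum_distrib_right[symmetric] sumG)
  also have "\<dots> = (\<Sum>x<n. a $ x * cnj (b $ x))"
  proof (rule sum.cong[OF refl])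
    fix x assume "x \<in> {..<n}"
    moreover have "(\<Sum>y<n. (if x = y then 1 else 0) * a $ y * cnj (b $ x)) =
        (\<Sum>y<n. if x = y then a $ y * cnj (b $ x) else 0)"
      by (rule sum.cong) auto
    ultimately show "(\<Sum>y<n. (if x = y then 1 else 0) * a $ y * cnj (b $ x)) = a $ x * cnj (b $ x)"
      by simp
  qed
  finally show ?thesis using ab by (simp add: inner_conv_sum[of _ n])
qed

section \<open>The matrix exponential on eigenvectors\<close>

lemma mat_exp_carrier: "A \<in> carrier_mat n n \<Longrightarrow> mat_exp A \<in> carrier_mat n n"
  by (simp add: mat_exp_def)

lemma pow_mat_eigenvector:
  fixes A :: "complex mat"
  assumes "A \<in> carrier_mat n n" "v \<in> carrier_vec n" "A *\<^sub>v v = l \<cdot>\<^sub>v v"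
  shows "A ^\<^sub>m k *\<^sub>v v = l ^ k \<cdot>\<^sub>v v"
proof (induction k)
  case 0
  then show ?case using assms by simp
next
  case (Suc k)
  have "A ^\<^sub>m Suc k *\<^sub>v v = A ^\<^sub>m k *\<^sub>v (l \<cdot>\<^sub>v v)"
    using assms by (simp add: assoc_mult_mat_vec[of _ n n _ n])
  also have "\<dots> = l ^ Suc k \<cdot>\<^sub>v v"
    using assms Suc by (simp add: mult_mat_vec[of _ n n] smult_smult_assoc)
  finally show ?case .
qed

text \<open>A crude majorant, the sum of the moduli of all entries, is enough to dominate the
  entrywise exponential series by a scalar one.\<close>

lemma pow_mat_entry_bound:
  assumes A: "A \<in> carrier_mat n n" and ij: "i < n" "j < n"
  shows "cmod ((A ^\<^sub>m k) $$ (i, j)) \<le> (\<Sum>x<n. \<Sum>y<n. cmod (A $$ (x, y))) ^ k"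
  using ij(2)
proof (induction k arbitrary: j)
  case 0
  then show ?case using ij A by simp
next
  case (Suc k)
  let ?r = "\<Sum>x<n. \<Sum>y<n. cmod (A $$ (x, y))"
  have "cmod ((A ^\<^sub>m Suc k) $$ (i, j)) \<le> (\<Sum>l<n. cmod ((A ^\<^sub>m k) $$ (i, l)) * cmod (A $$ (l, j)))"
    using A ij Suc.prems
    by (simp add: mat_mult_index[of _ n] del: index_mult_mat(1))
      (rule order_trans[OF norm_sum], simp add: norm_mult)
  also have "\<dots> \<le> (\<Sum>l<n. ?r ^ k * cmod (A $$ (l, j)))"
    by (intro sum_mono mult_right_mono Suc.IH) auto
  also have "\<dots> \<le> ?r ^ k * ?r"
    unfolding sum_distrib_left[symmetric]
  proof (intro mult_left_mono sum_mono)
    show "cmod (A $$ (l, j)) \<le> (\<Sum>y<n. cmod (A $$ (l, y)))" for l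
      using Suc.prems by (intro member_le_sum) auto
  qed (simp add: sum_nonneg)
  finally show ?case by (simp add: mult.commute)
qed

lemma mat_exp_eigenvector:
  assumes A: "A \<in> carrier_mat n n" and v: "v \<in> carrier_vec n" and eig: "A *\<^sub>v v = l \<cdot>\<^sub>v v"
  shows "mat_exp A *\<^sub>v v = exp l \<cdot>\<^sub>v v"
proof (rule eq_vecI)
  fix i assume "i < dim_vec (exp l \<cdot>\<^sub>v v)"
  then have i: "i < n" using v by simp
  have sm: "summable (\<lambda>k. (A ^\<^sub>m k) $$ (i, j) / fact k)" if "j < n" for j
  proof (rule summable_comparison_test')
    define r where "r = (\<Sum>x<n. \<Sum>y<n. cmod (A $$ (x, y)))"
    show "summable (\<lambda>k. inverse (fact k) * r ^ k)" by (rule summable_exp)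
    show "norm ((A ^\<^sub>m k) $$ (i, j) / fact k) \<le> inverse (fact k) * r ^ k" for k
      using divide_right_mono[OF pow_mat_entry_bound[OF A i that, of k], of "fact k"]
      by (simp add: norm_divide r_def field_simps)
  qed
  have "(\<lambda>k. (A ^\<^sub>m k) $$ (i, j) / fact k * v $ j) sums (mat_exp A $$ (i, j) * v $ j)" if "j < n" for j
    using summable_sums[OF sm[OF that]] A i that by (intro sums_mult2) (simp add: mat_exp_def)
  then have "(\<lambda>k. \<Sum>j<n. (A ^\<^sub>m k) $$ (i, j) / fact k * v $ j) sums (\<Sum>j<n. mat_exp A $$ (i, j) * v $ j)"
    by (intro sums_sum) simp
  moreover have "(\<Sum>j<n. (A ^\<^sub>m k) $$ (i, j) / fact k * v $ j) = l ^ k /\<^sub>R fact k * v $ i" for k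
  proof -
    have "(\<Sum>j<n. (A ^\<^sub>m k) $$ (i, j) / fact k * v $ j) = (A ^\<^sub>m k *\<^sub>v v) $ i / fact k"
      using A v i by (simp add: mat_vec_index[of _ n] sum_divide_distrib del: index_mult_mat_vec)
    then show ?thesis using v i
      by (simp add: pow_mat_eigenvector[OF A v eig] scaleR_conv_of_real field_simps del: index_mult_mat_vec)
  qed
  ultimately have "(\<lambda>k. l ^ k /\<^sub>R fact k * v $ i) sums (mat_exp A *\<^sub>v v) $ i"
    using mat_exp_carrier[OF A] v i by (simp add: mat_vec_index[of _ n] del: index_mult_mat_vec)
  moreover have "(\<lambda>k. l ^ k /\<^sub>R fact k * v $ i) sums (exp l * v $ i)"
    by (intro sums_mult2 exp_converges)
  ultimately show "(mat_exp A *\<^sub>v v) $ i = (exp l \<cdot>\<^sub>v v) $ i"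
    using sums_unique2 v i by (simp del: index_mult_mat_vec)
qed (use mat_exp_carrier[OF A] v in simp)

section \<open>An observable that detects the phase of the probe state\<close>

lemma smult_mat_vec:
  fixes A :: "complex mat"
  assumes "A \<in> carrier_mat n n" "v \<in> carrier_vec n"
  shows "(z \<cdot>\<^sub>m A) *\<^sub>v v = z \<cdot>\<^sub>v (A *\<^sub>v v)"
  using assms
  by (intro eq_vecI) (auto simp: mat_vec_index[of _ n] sum_distrib_left mult.assoc
      simp del: index_mult_mat_vec)

lemma vnorm_add4:
  assumes "a \<in> carrier_vec n" "b \<in> carrier_vec n" "c \<in> carrier_vec n" "d \<in> carrier_vec n"
  shows "vnorm (a + b + c + d) \<le> vnorm a + vnorm b + vnorm c + vnorm d"
  using vnorm_add[of "a + b + c" n d] vnorm_add[of "a + b" n c] vnorm_add[of a n b] assms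
  by simp

text \<open>Here \<open>p\<close>, \<open>m\<close>, \<open>r\<close>, \<open>s\<close> stand for
  the kets at M, -M, -3M, 3M and \<open>\<alpha>\<close> for the phase acquired by the first;
  \<open>U\<close> lowers and \<open>V\<close> raises by 2M, approximately. The phase
  \<open>z\<close> makes both overlaps that survive orthogonality real and equal to 1 up to the
  common factor M / 2, whatever \<open>\<alpha>\<close> is.\<close>

lemma probe_observable_estimate:
  fixes p m r s :: "complex vec" and \<alpha> z :: complex and M t \<kappa> :: real
  assumes carrier: "p \<in> carrier_vec n" "m \<in> carrier_vec n" "r \<in> carrier_vec n" "s \<in> carrier_vec n"
    and norm: "vnorm p = 1" "vnorm m = 1" "vnorm r = 1" "vnorm s = 1"
    and orth: "m \<bullet>c p = 0" "p \<bullet>c m = 0" "r \<bullet>c p = 0" "r \<bullet>c m = 0" "s \<bullet>c p = 0" "s \<bullet>c m = 0"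
    and UV: "U \<in> carrier_mat n n" "V \<in> carrier_mat n n"
    and approx: "vnorm (U *\<^sub>v p - m) \<le> t" "vnorm (U *\<^sub>v m - complex_of_real \<kappa> \<cdot>\<^sub>v r) \<le> t"
      "vnorm (V *\<^sub>v m - p) \<le> t" "vnorm (V *\<^sub>v p - complex_of_real \<kappa> \<cdot>\<^sub>v s) \<le> t"
    and \<kappa>: "0 \<le> \<kappa>" "\<kappa> \<le> 1" and t: "t \<le> 1/8" and M: "0 < M" and \<alpha>: "cmod \<alpha> = 1"
  defines "z \<equiv> \<i> * (cnj \<alpha>)\<^sup>2"
  defines "\<psi> \<equiv> complex_of_real (1 / sqrt 2) \<cdot>\<^sub>v (\<alpha> \<cdot>\<^sub>v p + cnj \<alpha> \<cdot>\<^sub>v m)"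
    and "\<psi>' \<equiv> complex_of_real (M / sqrt 2) \<cdot>\<^sub>v ((- \<i> * \<alpha>) \<cdot>\<^sub>v p + (\<i> * cnj \<alpha>) \<cdot>\<^sub>v m)"
    and "X \<equiv> z \<cdot>\<^sub>m U + cnj z \<cdot>\<^sub>m V"
  shows "vnorm (X *\<^sub>v \<psi>) \<le> 5" "M / 2 \<le> Re ((X *\<^sub>v \<psi>) \<bullet>c \<psi>')" "vnorm \<psi>' \<le> sqrt 2 * M"
proof -
  define h where "h = complex_of_real (1 / sqrt 2)"
  have hn: "cmod h = 1 / sqrt 2" by (simp add: h_def norm_divide)
  have hh: "h * h = 1/2"
    unfolding h_def of_real_mult[symmetric] by simp
  have s2: "1 \<le> sqrt 2" by simp
  have zn: "cmod z = 1" using \<alpha> by (simp add: z_def norm_mult norm_power)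
  have \<alpha>c: "\<alpha> * cnj \<alpha> = 1" using \<alpha> by (simp add: complex_norm_square[symmetric])
  define d1 where "d1 = U *\<^sub>v p - m"
  define d2 where "d2 = U *\<^sub>v m - complex_of_real \<kappa> \<cdot>\<^sub>v r"
  define d3 where "d3 = V *\<^sub>v m - p"
  define d4 where "d4 = V *\<^sub>v p - complex_of_real \<kappa> \<cdot>\<^sub>v s"
  have d: "d1 \<in> carrier_vec n" "d2 \<in> carrier_vec n" "d3 \<in> carrier_vec n" "d4 \<in> carrier_vec n"
    using carrier UV by (simp_all add: d1_def d2_def d3_def d4_def)
  \<comment> \<open>\<open>\<chi>\<close> is the image of \<open>\<psi>\<close> if all four
    approximations were exact; its overlap with \<open>\<psi>'\<close> is exactly \<open>M\<close>.
    \<open>\<epsilon>\<close> collects the errors.\<close>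
  define \<chi> where "\<chi> = h \<cdot>\<^sub>v ((z * \<alpha>) \<cdot>\<^sub>v m + (z * cnj \<alpha> * of_real \<kappa>) \<cdot>\<^sub>v r
      + (cnj z * cnj \<alpha>) \<cdot>\<^sub>v p + (cnj z * \<alpha> * of_real \<kappa>) \<cdot>\<^sub>v s)"
  define \<epsilon> where "\<epsilon> = h \<cdot>\<^sub>v ((z * \<alpha>) \<cdot>\<^sub>v d1 + (z * cnj \<alpha>) \<cdot>\<^sub>v d2
      + (cnj z * cnj \<alpha>) \<cdot>\<^sub>v d3 + (cnj z * \<alpha>) \<cdot>\<^sub>v d4)"
  have c: "\<chi> \<in> carrier_vec n" "\<epsilon> \<in> carrier_vec n" "\<psi> \<in> carrier_vec n" "\<psi>' \<in> carrier_vec n"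
    using carrier d by (simp_all add: \<chi>_def \<epsilon>_def \<psi>_def \<psi>'_def)
  have W: "W *\<^sub>v \<psi> = h \<cdot>\<^sub>v (\<alpha> \<cdot>\<^sub>v (W *\<^sub>v p) + cnj \<alpha> \<cdot>\<^sub>v (W *\<^sub>v m))" if "W \<in> carrier_mat n n" for W
    using that carrier unfolding \<psi>_def h_def
    by (simp add: mult_mat_vec[of _ n n] mult_add_distrib_mat_vec[of _ n n])
  have "X *\<^sub>v \<psi> = z \<cdot>\<^sub>v (U *\<^sub>v \<psi>) + cnj z \<cdot>\<^sub>v (V *\<^sub>v \<psi>)"
    using UV c unfolding X_def by (simp add: add_mult_distrib_mat_vec[of _ n n] smult_mat_vec[of _ n])
  then have X: "X *\<^sub>v \<psi> = \<chi> + \<epsilon>"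
    unfolding W[OF UV(1)] W[OF UV(2)]
    using carrier UV carrier_matD[OF UV(1)] carrier_matD[OF UV(2)]
    by (intro eq_vecI) (auto simp: \<chi>_def \<epsilon>_def d1_def d2_def d3_def d4_def algebra_simps
        simp del: index_mult_mat_vec)
  have "vnorm \<epsilon> \<le> 1 / sqrt 2 * (vnorm d1 + vnorm d2 + vnorm d3 + vnorm d4)"
    unfolding \<epsilon>_def vnorm_smult hn
    using vnorm_add4[of "(z * \<alpha>) \<cdot>\<^sub>v d1" n "(z * cnj \<alpha>) \<cdot>\<^sub>v d2" "(cnj z * cnj \<alpha>) \<cdot>\<^sub>v d3" "(cnj z * \<alpha>) \<cdot>\<^sub>v d4"] d
    by (simp add: vnorm_smult norm_mult zn \<alpha> divide_right_mono)
  \<comment> \<open>Four errors of at most 1/8 each: with this threshold for \<open>t\<close> at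
    least half of the signal \<open>M\<close> survives.\<close>
  also have "\<dots> \<le> 1 / sqrt 2 * (1/2)"
    using approx t by (intro mult_left_mono) (auto simp: d1_def d2_def d3_def d4_def)
  finally have \<epsilon>: "vnorm \<epsilon> \<le> 1 / sqrt 2 * (1/2)" .
  have "vnorm \<chi> \<le> 1 / sqrt 2 * (1 + \<kappa> + 1 + \<kappa>)"
    unfolding \<chi>_def vnorm_smult hn
    using vnorm_add4[of "(z * \<alpha>) \<cdot>\<^sub>v m" n "(z * cnj \<alpha> * of_real \<kappa>) \<cdot>\<^sub>v r" "(cnj z * cnj \<alpha>) \<cdot>\<^sub>v p"
      "(cnj z * \<alpha> * of_real \<kappa>) \<cdot>\<^sub>v s"] carrier \<kappa>
    by (simp add: vnorm_smult norm_mult zn \<alpha> norm divide_right_mono)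
  also have "\<dots> \<le> 1 / sqrt 2 * 4" using \<kappa> by (intro mult_left_mono) auto
  finally have \<chi>: "vnorm \<chi> \<le> 1 / sqrt 2 * 4" .
  have "vnorm (X *\<^sub>v \<psi>) \<le> 1 / sqrt 2 * (9/2)"
    unfolding X using vnorm_add[OF c(1,2)] \<epsilon> \<chi> by simp
  also have "\<dots> \<le> 1 * (9/2)" using s2 by (intro mult_right_mono) auto
  finally show "vnorm (X *\<^sub>v \<psi>) \<le> 5" by simp
  \<comment> \<open>The triangle inequality loses a factor sqrt 2 against the exact norm
    \<open>M\<close>; this turns 4 M^2 into the upper bound 8 M^2.\<close>
  have "vnorm \<psi>' \<le> M / sqrt 2 * 2"
    unfolding \<psi>'_def vnorm_smult
    using vnorm_add[of "(- \<i> * \<alpha>) \<cdot>\<^sub>v p" n "(\<i> * cnj \<alpha>) \<cdot>\<^sub>v m"] carrier M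
    by (simp add: vnorm_smult norm_mult \<alpha> norm norm_divide divide_right_mono)
  also have "\<dots> = sqrt 2 * M" using M real_div_sqrt[of 2] by (simp add: field_simps)
  finally show \<psi>': "vnorm \<psi>' \<le> sqrt 2 * M" .
  have pp: "p \<bullet>c p = 1" "m \<bullet>c m = 1" using norm by (simp_all add: inner_self)
  note inner_simps = inner_add_left[of _ n] inner_add_right[of _ n] inner_smult_left[of _ n] inner_smult_right[of _ n]
  have "\<chi> \<bullet>c \<psi>' = (h * h) * of_real M *
      (z * \<alpha> * cnj (\<i> * cnj \<alpha>) + cnj z * cnj \<alpha> * cnj (- \<i> * \<alpha>))"
  proof -
    have "\<chi> \<bullet>c p = h * (cnj z * cnj \<alpha>)" "\<chi> \<bullet>c m = h * (z * \<alpha>)"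
      unfolding \<chi>_def using carrier by (simp_all add: inner_simps orth pp)
    moreover have "\<chi> \<bullet>c \<psi>' = cnj (of_real (M / sqrt 2)) *
        (cnj (- \<i> * \<alpha>) * (\<chi> \<bullet>c p) + cnj (\<i> * cnj \<alpha>) * (\<chi> \<bullet>c m))"
      unfolding \<psi>'_def using carrier c(1) by (simp add: inner_simps)
    ultimately show ?thesis by (simp add: h_def algebra_simps)
  qed
  also have "z * \<alpha> * cnj (\<i> * cnj \<alpha>) = (\<alpha> * cnj \<alpha>)\<^sup>2"
    by (simp add: z_def power2_eq_square algebra_simps)
  also have "cnj z * cnj \<alpha> * cnj (- \<i> * \<alpha>) = (\<alpha> * cnj \<alpha>)\<^sup>2"
    by (simp add: z_def power2_eq_square algebra_simps)
  finally have main: "\<chi> \<bullet>c \<psi>' = of_real M" by (simp add: \<alpha>c hh)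
  have "cmod (\<epsilon> \<bullet>c \<psi>') \<le> vnorm \<epsilon> * vnorm \<psi>'" by (rule inner_Cauchy_Schwarz[OF c(2,4)])
  also have "\<dots> \<le> (1 / sqrt 2 * (1/2)) * (sqrt 2 * M)"
    using \<epsilon> \<psi>' by (intro mult_mono) simp_all
  finally have "cmod (\<epsilon> \<bullet>c \<psi>') \<le> M / 2" by simp
  moreover have "Re ((X *\<^sub>v \<psi>) \<bullet>c \<psi>') = M + Re (\<epsilon> \<bullet>c \<psi>')"
    unfolding X inner_add_left[OF c(1,2,4)] main by simp
  ultimately show "M / 2 \<le> Re ((X *\<^sub>v \<psi>) \<bullet>c \<psi>')"
    using abs_Re_le_cmod[of "\<epsilon> \<bullet>c \<psi>'"] by simp
qed

text \<open>For vectors K_j v with velocities K_j v', completeness collapses the sums over j. An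
  \<open>X\<close> that commutes with every Kraus operator first slides past it, so the noise drops
  out of the lower bound.\<close>

lemma channel_qfi_bounds:
  assumes Ks: "set Ks \<subseteq> carrier_mat n n"
    and one: "mat_sum n (map (\<lambda>K. mat_adjoint K * K) Ks) = 1\<^sub>m n"
    and v: "v \<in> carrier_vec n" "v' \<in> carrier_vec n"
  defines "F \<equiv> qfi (apply_channel n Ks (rank_one n v v))
    (apply_channel n Ks (rank_one n v' v + rank_one n v v'))"
  shows "F \<le> 4 * (vnorm v')\<^sup>2"
    and "\<lbrakk>X \<in> carrier_mat n n; hermitian X; \<And>K. K \<in> set Ks \<Longrightarrow> K * X = X * K\<rbrakk> \<Longrightarrow>
      4 * (Re ((X *\<^sub>v v) \<bullet>c v'))\<^sup>2 \<le> (vnorm (X *\<^sub>v v))\<^sup>2 * F"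
proof -
  have kc: "kraus n Ks j \<in> carrier_mat n n" for j using Ks by simp
  interpret outer_sum_derivative n "length Ks" "\<lambda>j. kraus n Ks j *\<^sub>v v" "\<lambda>j. kraus n Ks j *\<^sub>v v'"
    using kc v by unfold_locales simp_all
  have F: "F = qfi \<sigma> \<sigma>'"
    unfolding F_def \<sigma>_def \<sigma>'_def using Ks v
    by (simp add: apply_channel_add[of _ n] apply_channel_rank_one)
  have norm_sum: "(\<Sum>j<length Ks. (vnorm (kraus n Ks j *\<^sub>v a))\<^sup>2) = (vnorm a)\<^sup>2" if "a \<in> carrier_vec n" for a
    using kraus_sum_inner[OF Ks one that that] unfolding inner_self
    by (simp only: of_real_sum[symmetric] of_real_eq_iff)
  show "F \<le> 4 * (vnorm v')\<^sup>2"
    using qfi_le norm_sum[OF v(2)] by (simp add: F)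
  assume X: "X \<in> carrier_mat n n" "hermitian X" and comm: "\<And>K. K \<in> set Ks \<Longrightarrow> K * X = X * K"
  have XK: "X *\<^sub>v (kraus n Ks j *\<^sub>v v) = kraus n Ks j *\<^sub>v (X *\<^sub>v v)" for j
  proof -
    have "X * kraus n Ks j = kraus n Ks j * X"
      using comm[of "Ks ! j"] X by (cases "j < length Ks") (auto simp: kraus_def)
    then show ?thesis
      using assoc_mult_mat_vec[OF X(1) kc[of j] v(1)] assoc_mult_mat_vec[OF kc[of j] X(1) v(1)] by simp
  qed
  have Xv: "X *\<^sub>v v \<in> carrier_vec n" using X v by simp
  have "(\<Sum>j<length Ks. Re ((kraus n Ks j *\<^sub>v (X *\<^sub>v v)) \<bullet>c (kraus n Ks j *\<^sub>v v'))) = Re ((X *\<^sub>v v) \<bullet>c v')"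
    using arg_cong[OF kraus_sum_inner[OF Ks one Xv v(2)], of Re] by simp
  then show "4 * (Re ((X *\<^sub>v v) \<bullet>c v'))\<^sup>2 \<le> (vnorm (X *\<^sub>v v))\<^sup>2 * F"
    using qfi_ge[OF X] by (simp add: XK norm_sum[OF Xv] F)
qed

section \<open>Quantum Fisher information of the noisy probe state\<close>

lemma magnetic_numbers_uminus:
  assumes "2 * J \<in> \<nat>" "m \<in> magnetic_numbers J"
  shows "- m \<in> magnetic_numbers J"
proof -
  obtain l :: nat where l: "2 * J = real l" using assms(1) by (auto elim: Nats_cases)
  obtain k :: nat where k: "m = - J + real k" "m \<le> J"
    using assms(2) by (auto simp: magnetic_numbers_def)
  then have "k \<le> l" using l by simp
  then have "- m = - J + real (l - k)" using k l by (simp add: of_nat_diff)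
  moreover have "- m \<le> J" using k by simp
  ultimately show ?thesis unfolding magnetic_numbers_def by blast
qed

lemma magnetic_numbers_diff:
  assumes "m \<in> magnetic_numbers J" "real i \<le> J + m"
  shows "m - real i \<in> magnetic_numbers J"
proof -
  obtain k :: nat where k: "m = - J + real k" "m \<le> J"
    using assms(1) by (auto simp: magnetic_numbers_def)
  then have "i \<le> k" using assms(2) by simp
  then have "m - real i = - J + real (k - i)" using k by (simp add: of_nat_diff)
  moreover have "m - real i \<le> J" using k(2) by simp
  ultimately show ?thesis unfolding magnetic_numbers_def by blast
qed

text \<open>The number of ladder steps from \<open>m\<close> to \<open>- m\<close> is an integer
  even when \<open>m\<close> is half-integral.\<close>

lemma magnetic_number_twice_Nats:
  assumes "2 * J \<in> \<nat>" "m \<in> magnetic_numbers J" "0 \<le> m"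
  shows "\<exists>K::nat. real K = 2 * m"
proof -
  obtain l :: nat where l: "2 * J = real l" using assms(1) by (auto elim: Nats_cases)
  obtain k :: nat where k: "m = - J + real k" using assms(2) by (auto simp: magnetic_numbers_def)
  have "2 * m = real (2 * k) - real l" using k l by simp
  moreover from this have "l \<le> 2 * k" using assms(3) by linarith
  ultimately have "2 * m = real (2 * k - l)" by (simp add: of_nat_diff)
  then show ?thesis by metis
qed

text \<open>The non-asymptotic core, with all smallness gathered in \<open>small\<close>. The
  condition \<open>3 * M \<le> J\<close> makes room for the kets at 3M and -3M, reached when a probe
  ket is shifted away from the other one.\<close>

lemma noisy_qfi_bounds:
  fixes J M r :: real
  assumes D: "0 < D"
    and q: "qz \<in> carrier_mat D D" "qp \<in> carrier_mat D D" "hermitian qz" "qm = mat_adjoint qp"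
    and r: "\<And>i j. i < D \<Longrightarrow> j < D \<Longrightarrow> cmod (qp $$ (i, j)) \<le> r"
    and mult: "spin_multiplet (D ^ N) (total_op N D qz) (total_op N D qp) (total_op N D qm) J ket"
    and M: "0 < M" "M \<in> magnetic_numbers J" "3 * M \<le> J" "real K = 2 * M"
    and A: "A \<subseteq> {..<N}" and Ks: "noise_channel_on N D A Ks"
    and small: "(1 + real (card A) * (real D * r) / lower_coeff J M) ^ K - 1 \<le> 1/8"
  shows "M\<^sup>2 / 25 \<le> noisy_qfi N D qz ket M Ks \<theta>"
    and "noisy_qfi N D qz ket M Ks \<theta> \<le> 8 * M\<^sup>2"
proof -
  define n where "n = D ^ N"
  define B where "B = {..<N} - A"
  define Qz Qp Qm where "Qz = total_op N D qz" and "Qp = total_op N D qp" and "Qm = total_op N D qm"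
  define Lp Lm Bp Bm where "Lp = partial_op N D qp A" and "Lm = partial_op N D qm A"
    and "Bp = partial_op N D qp B" and "Bm = partial_op N D qm B"
  have AB: "A \<inter> B = {}" "A \<union> B = {..<N}" "B \<subseteq> {..<N}" "finite A" "finite B"
    using A finite_subset[OF A] by (auto simp: B_def)
  have qm: "qm \<in> carrier_mat D D" "qp = mat_adjoint qm"
    using q by (simp_all add: q(4), intro eq_matI, auto)
  have rm: "cmod (qm $$ (i, j)) \<le> r" if "i < D" "j < D" for i j
    using r[OF that(2,1)] q(2) that by (simp add: q(4))
  have r0: "0 \<le> r" using order_trans[OF norm_ge_zero r[OF D D]] .
  have Qc: "Qz \<in> carrier_mat n n" "Qp \<in> carrier_mat n n" "Qm \<in> carrier_mat n n"
    and Pc: "Lp \<in> carrier_mat n n" "Lm \<in> carrier_mat n n" "Bp \<in> carrier_mat n n" "Bm \<in> carrier_mat n n"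
    by (simp_all add: Qz_def Qp_def Qm_def Lp_def Lm_def Bp_def Bm_def n_def)
  have split: "Qp = Lp + Bp" "Qm = Lm + Bm"
    unfolding Qp_def Qm_def Lp_def Lm_def Bp_def Bm_def total_op_conv_partial_op
    using partial_op_union[OF AB(4,5,1), of N D] unfolding AB(2) by simp_all
  have comm: "Lp * Bp = Bp * Lp" "Lm * Bm = Bm * Lm"
    unfolding Lp_def Lm_def Bp_def Bm_def
    by (rule partial_op_partial_op_commute[OF D A AB(3,1)])+
  have Qzh: "hermitian Qz"
    unfolding hermitian_def Qz_def total_op_conv_partial_op partial_op_adjoint[OF D q(1)]
    using q(3) by (simp add: hermitian_def)
  have Bmp: "mat_adjoint Bm = Bp" "mat_adjoint Bp = Bm"
    unfolding Bm_def Bp_def partial_op_adjoint[OF D qm(1)] partial_op_adjoint[OF D q(2)]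
    using qm(2) q(4) by simp_all
  define Q where "Q = real (card A) * (real D * r)"
  have Q0: "0 \<le> Q" using r0 by (simp add: Q_def)
  have Lnorm: "vnorm (Lp *\<^sub>v v) \<le> Q * vnorm v" "vnorm (Lm *\<^sub>v v) \<le> Q * vnorm v" if "v \<in> carrier_vec n" for v
    unfolding Lp_def Lm_def Q_def using that AB(4) D r rm
    by (auto simp: n_def intro!: vnorm_partial_op)

  have J: "2 * J \<in> \<nat>" using mult by (simp add: spin_multiplet_def)
  have ket: "ket m \<in> carrier_vec n" "Qz *\<^sub>v ket m = complex_of_real m \<cdot>\<^sub>v ket m"
    if "m \<in> magnetic_numbers J" for m
    using mult that by (simp_all add: spin_multiplet_def n_def Qz_def)
  have inner: "ket m \<bullet>c ket m' = (if m = m' then 1 else 0)"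
    if "m \<in> magnetic_numbers J" "m' \<in> magnetic_numbers J" for m m'
    using mult that by (simp add: spin_multiplet_def)
  have ket_norm: "vnorm (ket m) = 1" if "m \<in> magnetic_numbers J" for m
  proof -
    have "(vnorm (ket m))\<^sup>2 = 1" using inner[OF that that] unfolding inner_self by (simp only: of_real_eq_1_iff simp_thms if_True)
    then show ?thesis using vnorm_nonneg[of "ket m"] by (simp add: power2_eq_1_iff)
  qed
  have lower: "Qm *\<^sub>v ket m = complex_of_real (lower_coeff J m) \<cdot>\<^sub>v ket (m - 1)"
    if "m \<in> magnetic_numbers J" "m \<noteq> - J" for m
    using mult that by (simp add: spin_multiplet_def Qm_def lower_coeff_def)
  have raise: "Qp *\<^sub>v ket m = complex_of_real (lower_coeff J (- m)) \<cdot>\<^sub>v ket (m + 1)"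
    if "m \<in> magnetic_numbers J" "m \<noteq> J" for m
    using mult that by (simp add: spin_multiplet_def Qp_def lower_coeff_def)
  have i_le: "real i \<le> 4 * M" if "i \<le> 2 * K" for i
  proof -
    have "real i \<le> real (2 * K)" using that by (simp only: of_nat_le_iff)
    then show ?thesis using M(4) by simp
  qed
  have i_less: "real i < 4 * M" if "i < 2 * K" for i
  proof -
    have "real i < real (2 * K)" using that by (simp only: of_nat_less_iff)
    then show ?thesis using M(4) by simp
  qed
  have mag: "M - real i \<in> magnetic_numbers J" if "i \<le> 2 * K" for i
    using M i_le[OF that] by (intro magnetic_numbers_diff) auto
  have mag': "- (M - real i) \<in> magnetic_numbers J" if "i \<le> 2 * K" for i
    using mag[OF that] by (rule magnetic_numbers_uminus[OF J])
  \<comment> \<open>Since \<open>2 * K\<close> steps amount to 4M, they lead from M to -3M;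
    reflection gives 3M.\<close>
  have mags: "M \<in> magnetic_numbers J" "- M \<in> magnetic_numbers J"
    "3 * M \<in> magnetic_numbers J" "- (3 * M) \<in> magnetic_numbers J"
    using M mag[of "2 * K"] mag'[of 0] mag'[of "2 * K"] by simp_all

  define P \<kappa> where "P = (\<Prod>i<K. lower_coeff J (M - real i))"
    and "\<kappa> = (\<Prod>i<K. lower_coeff J (- M - real i)) / (\<Prod>i<K. lower_coeff J (M - real i))"
  define U V where "U = complex_of_real (1 / P) \<cdot>\<^sub>m Bm ^\<^sub>m K" and "V = complex_of_real (1 / P) \<cdot>\<^sub>m Bp ^\<^sub>m K"
  have UV: "U \<in> carrier_mat n n" "V \<in> carrier_mat n n"
    using Pc by (simp_all add: U_def V_def)
  have down_step: "Qm *\<^sub>v ket (M - real i) = complex_of_real (lower_coeff J (M - real i)) \<cdot>\<^sub>v ket (M - real i - 1)"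
    if "i < 2 * K" for i
    using that mag[of i] i_less[OF that] M(3) by (intro lower) auto
  have up_step: "Qp *\<^sub>v ket (- (M - real i)) = complex_of_real (lower_coeff J (M - real i)) \<cdot>\<^sub>v ket (- (M - real i - 1))"
    if "i < 2 * K" for i
    using raise[of "- (M - real i)"] that mag'[of i] i_less[OF that] M(3) by (auto simp: algebra_simps)
  note down = ladder_transfer[OF Pc(4,2) split(2) comm(2) Q0 Lnorm(2) M(4,1,3), of ket,
      OF _ _ down_step, folded P_def \<kappa>_def]
  \<comment> \<open>Reflecting the kets turns raising into lowering with the same coefficients,
    hence with the same \<open>P\<close> and \<open>\<kappa>\<close>.\<close>
  note up = ladder_transfer[OF Pc(3,1) split(1) comm(1) Q0 Lnorm(1) M(4,1,3), of "\<lambda>m. ket (- m)",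
      OF _ _ up_step, folded P_def \<kappa>_def]
  have kets: "ket (M - real i) \<in> carrier_vec n \<and> vnorm (ket (M - real i)) = 1"
    "ket (- (M - real i)) \<in> carrier_vec n \<and> vnorm (ket (- (M - real i))) = 1" if "i \<le> 2 * K" for i
    using mag[OF that] mag'[OF that] ket ket_norm by blast+
  have \<kappa>: "0 \<le> \<kappa>" "\<kappa> \<le> 1"
    by (rule down(2,3); (assumption | erule kets(1)))+
  define t where "t = (1 + Q / lower_coeff J M) ^ K - 1"
  have approx: "vnorm (U *\<^sub>v ket M - ket (- M)) \<le> t"
    "vnorm (U *\<^sub>v ket (- M) - complex_of_real \<kappa> \<cdot>\<^sub>v ket (- (3 * M))) \<le> t"
    "vnorm (V *\<^sub>v ket (- M) - ket M) \<le> t"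
    "vnorm (V *\<^sub>v ket M - complex_of_real \<kappa> \<cdot>\<^sub>v ket (3 * M)) \<le> t"
  proof -
    have "vnorm (complex_of_real (1 / P) \<cdot>\<^sub>v (Bm ^\<^sub>m K *\<^sub>v ket M) - ket (- M)) \<le> t"
      unfolding t_def by (rule down(4); (assumption | erule kets(1)))
    moreover have "vnorm (complex_of_real (1 / P) \<cdot>\<^sub>v (Bm ^\<^sub>m K *\<^sub>v ket (- M)) -
        complex_of_real \<kappa> \<cdot>\<^sub>v ket (- (3 * M))) \<le> t"
      unfolding t_def by (rule down(5); (assumption | erule kets(1)))
    moreover have "vnorm (complex_of_real (1 / P) \<cdot>\<^sub>v (Bp ^\<^sub>m K *\<^sub>v ket (- M)) - ket (- (- M))) \<le> t"
      unfolding t_def by (rule up(4); (assumption | erule kets(2)))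
    moreover have "vnorm (complex_of_real (1 / P) \<cdot>\<^sub>v (Bp ^\<^sub>m K *\<^sub>v ket (- (- M))) -
        complex_of_real \<kappa> \<cdot>\<^sub>v ket (- (- (3 * M)))) \<le> t"
      unfolding t_def by (rule up(5); (assumption | erule kets(2)))
    ultimately show "vnorm (U *\<^sub>v ket M - ket (- M)) \<le> t"
      "vnorm (U *\<^sub>v ket (- M) - complex_of_real \<kappa> \<cdot>\<^sub>v ket (- (3 * M))) \<le> t"
      "vnorm (V *\<^sub>v ket (- M) - ket M) \<le> t"
      "vnorm (V *\<^sub>v ket M - complex_of_real \<kappa> \<cdot>\<^sub>v ket (3 * M)) \<le> t"
      unfolding U_def V_def minus_minus
      using smult_mat_vec[OF pow_mat_carrier[OF Pc(3)] ket(1)[OF mags(1)]]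
        smult_mat_vec[OF pow_mat_carrier[OF Pc(3)] ket(1)[OF mags(2)]]
        smult_mat_vec[OF pow_mat_carrier[OF Pc(4)] ket(1)[OF mags(1)]]
        smult_mat_vec[OF pow_mat_carrier[OF Pc(4)] ket(1)[OF mags(2)]]
      by simp_all
  qed

  define \<alpha> where "\<alpha> = exp (- \<i> * complex_of_real \<theta> * complex_of_real M)"
  have \<alpha>: "cmod \<alpha> = 1" by (simp add: \<alpha>_def)
  have cnj\<alpha>: "cnj \<alpha> = exp (- \<i> * complex_of_real \<theta> * complex_of_real (- M))"
    by (simp add: \<alpha>_def exp_cnj)
  define \<psi> where "\<psi> = probe_vec Qz ket M \<theta>"
  have \<psi>: "\<psi> = complex_of_real (1 / sqrt 2) \<cdot>\<^sub>v (\<alpha> \<cdot>\<^sub>v ket M + cnj \<alpha> \<cdot>\<^sub>v ket (- M))"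
  proof -
    have sc: "(- \<i> * complex_of_real \<theta>) \<cdot>\<^sub>m Qz \<in> carrier_mat n n" using Qc by simp
    define E where "E = mat_exp ((- \<i> * complex_of_real \<theta>) \<cdot>\<^sub>m Qz)"
    have Ec: "E \<in> carrier_mat n n" unfolding E_def by (rule mat_exp_carrier[OF sc])
    have E: "E *\<^sub>v ket m = exp (- \<i> * complex_of_real \<theta> * complex_of_real m) \<cdot>\<^sub>v ket m"
      if "m \<in> magnetic_numbers J" for m
      unfolding E_def using ket[OF that] Qc
      by (intro mat_exp_eigenvector[OF sc]) (simp_all add: smult_mat_vec[of _ n] smult_smult_assoc)
    have "E *\<^sub>v ket M = \<alpha> \<cdot>\<^sub>v ket M" "E *\<^sub>v ket (- M) = cnj \<alpha> \<cdot>\<^sub>v ket (- M)"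
      unfolding \<alpha>_def cnj\<alpha>[unfolded \<alpha>_def] by (rule E[OF mags(1)], rule E[OF mags(2)])
    then show ?thesis
      using Ec ket(1)[OF mags(1)] ket(1)[OF mags(2)]
      unfolding \<psi>_def probe_vec_def probe_vec0_def E_def[symmetric]
      by (simp add: mult_mat_vec[of _ n n] mult_add_distrib_mat_vec[of _ n n])
  qed
  have \<psi>c: "\<psi> \<in> carrier_vec n" using ket(1)[OF mags(1)] ket(1)[OF mags(2)] by (simp add: \<psi>)
  define \<psi>' where "\<psi>' = (- \<i>) \<cdot>\<^sub>v (Qz *\<^sub>v \<psi>)"
  have \<psi>': "\<psi>' = complex_of_real (M / sqrt 2) \<cdot>\<^sub>v ((- \<i> * \<alpha>) \<cdot>\<^sub>v ket M + (\<i> * cnj \<alpha>) \<cdot>\<^sub>v ket (- M))"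
  proof -
    note k = ket(1)[OF mags(1)] ket(1)[OF mags(2)]
    have "Qz *\<^sub>v \<psi> = complex_of_real (1 / sqrt 2) \<cdot>\<^sub>v
        (\<alpha> \<cdot>\<^sub>v (complex_of_real M \<cdot>\<^sub>v ket M) + cnj \<alpha> \<cdot>\<^sub>v (complex_of_real (- M) \<cdot>\<^sub>v ket (- M)))"
      using Qc k unfolding \<psi> ket(2)[OF mags(1), symmetric] ket(2)[OF mags(2), symmetric]
      by (simp add: mult_mat_vec[of _ n n] mult_add_distrib_mat_vec[of _ n n])
    then show ?thesis unfolding \<psi>'_def using k by (intro eq_vecI) (auto simp: field_simps)
  qed
  have \<psi>'c: "\<psi>' \<in> carrier_vec n" using Qc \<psi>c by (simp add: \<psi>'_def)
  have state: "probe_state Qz ket M \<theta> = rank_one n \<psi> \<psi>"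
    unfolding probe_state_def \<psi>_def[symmetric] using \<psi>c by (rule ket_bra_conv_rank_one)
  have deriv: "probe_deriv Qz ket M \<theta> = rank_one n \<psi>' \<psi> + rank_one n \<psi> \<psi>'"
    unfolding probe_deriv_def state \<psi>'_def by (rule hermitian_commutator_rank_one[OF Qc(1) Qzh \<psi>c])
  have F: "noisy_qfi N D qz ket M Ks \<theta> = qfi (apply_channel n Ks (rank_one n \<psi> \<psi>))
      (apply_channel n Ks (rank_one n \<psi>' \<psi> + rank_one n \<psi> \<psi>'))"
    unfolding noisy_qfi_def Qz_def[symmetric] n_def[symmetric] state deriv ..
  have KsA: "\<exists>k. K = local_op N D A k" if "K \<in> set Ks" for K
    using Ks that by (auto simp: noise_channel_on_def)
  have Ksc: "set Ks \<subseteq> carrier_mat n n" using KsA by (force simp: n_def)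
  have one: "mat_sum n (map (\<lambda>K. mat_adjoint K * K) Ks) = 1\<^sub>m n"
    using Ks by (simp add: noise_channel_on_def n_def)

  define z where "z = \<i> * (cnj \<alpha>)\<^sup>2"
  define X where "X = z \<cdot>\<^sub>m U + cnj z \<cdot>\<^sub>m V"
  have Xc: "X \<in> carrier_mat n n" using UV by (simp add: X_def)
  \<comment> \<open>The normalisation \<open>P\<close> enters as a real factor, so \<open>V\<close>
    is the adjoint of \<open>U\<close> and \<open>X\<close> is Hermitian for every complex
    \<open>z\<close>.\<close>
  have UVadj: "mat_adjoint U = V"
  proof -
    have a: "mat_adjoint (Bm ^\<^sub>m K) = Bp ^\<^sub>m K" using mat_adjoint_pow[OF Pc(4)] Bmp(1) by simp
    have c: "Bm ^\<^sub>m K \<in> carrier_mat n n" using Pc by simp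
    show ?thesis unfolding U_def V_def a[symmetric] using c by (intro eq_matI) auto
  qed
  have Xh: "hermitian X"
  proof -
    have "mat_adjoint X = X"
      unfolding X_def UVadj[symmetric] using UV(1) by (intro eq_matI) auto
    then show ?thesis by (simp add: hermitian_def)
  qed
  have Xcomm: "Kr * X = X * Kr" if Kr: "Kr \<in> set Ks" for Kr
  proof -
    obtain k where k: "Kr = local_op N D A k" using KsA[OF Kr] by blast
    have kc: "Kr \<in> carrier_mat n n" using Kr Ksc by auto
    have b: "Bm * Kr = Kr * Bm" "Bp * Kr = Kr * Bp"
      unfolding k Bm_def Bp_def using local_op_partial_op_commute[OF D A AB(3,1)] by simp_all
    have p: "Kr * Bm ^\<^sub>m K = Bm ^\<^sub>m K * Kr" "Kr * Bp ^\<^sub>m K = Bp ^\<^sub>m K * Kr"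
      using pow_mat_commute[OF Pc(4) kc b(1)] pow_mat_commute[OF Pc(3) kc b(2)] by simp_all
    have pc: "Bm ^\<^sub>m K \<in> carrier_mat n n" "Bp ^\<^sub>m K \<in> carrier_mat n n" using Pc by simp_all
    show ?thesis unfolding X_def U_def V_def using kc pc
      by (simp add: mult_add_distrib_mat[OF kc, of _ n] add_mult_distrib_mat[OF _ _ kc, of _ n]
          mult_smult_distrib[of _ n n _ n] mult_smult_assoc_mat[of _ n n _ n] p)
  qed
  have neq: "M \<noteq> - M" "3 * M \<noteq> M" "3 * M \<noteq> - M" using M(1) by simp_all
  note est = probe_observable_estimate[OF ket(1)[OF mags(1)] ket(1)[OF mags(2)] ket(1)[OF mags(4)]
      ket(1)[OF mags(3)] ket_norm[OF mags(1)] ket_norm[OF mags(2)] ket_norm[OF mags(4)] ket_norm[OF mags(3)]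
      _ _ _ _ _ _ UV approx \<kappa> _ M(1) \<alpha>, folded z_def, folded X_def \<psi> \<psi>']
  have t: "t \<le> 1/8" using small by (simp add: t_def Q_def)
  have X1: "vnorm (X *\<^sub>v \<psi>) \<le> 5" and X2: "M / 2 \<le> Re ((X *\<^sub>v \<psi>) \<bullet>c \<psi>')"
    and X3: "vnorm \<psi>' \<le> sqrt 2 * M"
    using est neq t by (simp_all add: inner mags)
  have "noisy_qfi N D qz ket M Ks \<theta> \<le> 4 * (vnorm \<psi>')\<^sup>2"
    unfolding F by (rule channel_qfi_bounds(1)[OF Ksc one \<psi>c \<psi>'c])
  also have "\<dots> \<le> 4 * (sqrt 2 * M)\<^sup>2"
    using X3 by (intro mult_left_mono power_mono) simp_all
  finally show "noisy_qfi N D qz ket M Ks \<theta> \<le> 8 * M\<^sup>2"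
    by (simp add: power_mult_distrib)
  \<comment> \<open>A signal of at least M / 2 against a norm of at most 5 yields 4 (M / 2)^2 / 25 =
    M^2 / 25.\<close>
  have "4 * (M / 2)\<^sup>2 \<le> 4 * (Re ((X *\<^sub>v \<psi>) \<bullet>c \<psi>'))\<^sup>2"
    using X2 M(1) by (intro mult_left_mono power_mono) simp_all
  also have low: "\<dots> \<le> (vnorm (X *\<^sub>v \<psi>))\<^sup>2 * noisy_qfi N D qz ket M Ks \<theta>"
    unfolding F by (rule channel_qfi_bounds(2)[OF Ksc one \<psi>c \<psi>'c Xc Xh Xcomm])
  finally have *: "M\<^sup>2 \<le> (vnorm (X *\<^sub>v \<psi>))\<^sup>2 * noisy_qfi N D qz ket M Ks \<theta>"
    by (simp add: power_divide)
  have "0 < M\<^sup>2" using M(1) by simp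
  \<comment> \<open>The sign is read off from the bound itself; without it the norm could not be
    replaced by 5.\<close>
  then have "0 \<le> noisy_qfi N D qz ket M Ks \<theta>"
    using * by (smt (verit) mult_nonneg_nonpos zero_le_power2)
  then have "(vnorm (X *\<^sub>v \<psi>))\<^sup>2 * noisy_qfi N D qz ket M Ks \<theta> \<le> 5\<^sup>2 * noisy_qfi N D qz ket M Ks \<theta>"
    using X1 by (intro mult_right_mono power_mono) simp_all
  with * show "M\<^sup>2 / 25 \<le> noisy_qfi N D qz ket M Ks \<theta>" by simp
qed

section \<open>Asymptotics\<close>

text \<open>The power is at most e^(K Q / g), where g is the coefficient at \<open>M\<close>. As
  \<open>3 * M \<le> J\<close> forces g >= J / 2, the exponent is at most 4 Q M / J <= 1/16, and
  e^(1/16) < 9/8; the 64 is chosen for this.\<close>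

lemma ladder_error_small:
  fixes J M Q :: real
  assumes M: "0 < M" "3 * M \<le> J" "real K = 2 * M" and Q: "0 \<le> Q" "64 * (Q * M) \<le> J"
  shows "(1 + Q / lower_coeff J M) ^ K - 1 \<le> 1/8"
proof -
  define g where "g = lower_coeff J M"
  have J: "0 < J" using M by simp
  have "(J / 2)\<^sup>2 \<le> J * (2/3 * J)" using J by (simp add: power2_eq_square field_simps)
  also have "\<dots> \<le> (J + M) * (J - M + 1)" using M J by (intro mult_mono) auto
  finally have g: "J / 2 \<le> g" unfolding g_def lower_coeff_def by (rule real_le_rsqrt)
  then have g0: "0 < g" using J by linarith
  have x: "0 \<le> Q / g" using Q(1) g0 by simp
  have le: "real K * (Q / g) \<le> 1/16"
  proof -
    have "real K * (Q / g) = 2 * (Q * M) / g" using M(3) by simp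
    also have "\<dots> \<le> (J / 32) / (J / 2)"
      using Q g g0 J M(1) by (intro frac_le) auto
    also have "\<dots> = 1/16" using J by simp
    finally show ?thesis .
  qed
  have "(1 + Q / g) ^ K \<le> exp (Q / g) ^ K"
    using x exp_ge_add_one_self[of "Q / g"] by (intro power_mono) simp_all
  also have "\<dots> = exp (real K * (Q / g))" by (simp only: exp_of_nat_mult)
  also have "\<dots> \<le> exp (1/16)" using le by simp
  also have "\<dots> \<le> 1 + 1/16 + (1/16)\<^sup>2" by (rule exp_bound) simp_all
  finally show ?thesis by (simp add: g_def power2_eq_square)
qed

lemma log_times_powr_tendsto_0:
  assumes "b < (a::real)"
  shows "(\<lambda>N. log 2 (real N) * real N powr (b - a)) \<longlonglongrightarrow> 0"
proof -
  have "((\<lambda>N. ln (real N) / real N powr (a - b)) \<longlongrightarrow> 0) sequentially"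
    using lim_ln_over_power[of "a - b"] assms by simp
  then have "((\<lambda>N. ln (real N) / real N powr (a - b) * (1 / ln 2)) \<longlongrightarrow> 0 * (1 / ln 2)) sequentially"
    by (intro tendsto_mult tendsto_const)
  moreover have "ln (real N) / real N powr (a - b) * (1 / ln 2) = log 2 (real N) * real N powr (b - a)" for N
    using powr_minus_divide[of "real N" "a - b"] by (simp add: log_def)
  ultimately show ?thesis by simp
qed

theorem mainTheorem4:
  fixes s a b c :: real
    and D :: nat
    and qz qp qm :: "complex mat"
    and J M :: "nat \<Rightarrow> real"
    and d :: "nat \<Rightarrow> nat"
    and ket :: "nat \<Rightarrow> real \<Rightarrow> complex vec"
  assumes spin: "s > 0" "real D = 2 * s + 1" "spin_irrep D qz qp qm"
    and exponents: "1/2 < b" "b < a" "a \<le> 1"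
    and c: "0 < c" "c < (a - b) / (4 * log 2 (2 * s + 1))"
    and J: "\<forall>\<^sub>F N in sequentially. J N \<le> s * real N"
      "J \<in> \<Theta>(\<lambda>N. real N powr a)"
    and multiplet: "\<forall>\<^sub>F N in sequentially.
      spin_multiplet (D ^ N) (total_op N D qz) (total_op N D qp) (total_op N D qm) (J N) (ket N)"
    and M: "\<forall>\<^sub>F N in sequentially. M N > 0 \<and> M N \<in> magnetic_numbers (J N)"
      "M \<in> \<Theta>(\<lambda>N. real N powr b)"
    and d: "(\<lambda>N. real (d N) / log 2 (real N)) \<longlonglongrightarrow> c"
  shows "(\<exists>C1>0. \<exists>C2>0. \<forall>\<^sub>F N in sequentially. \<forall>\<theta> A Ks.
            A \<subseteq> {..<N} \<and> card A = d N \<and> noise_channel_on N D A Ks \<longrightarrow>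
            C1 * real N powr (2 * b) \<le> noisy_qfi N D qz (ket N) (M N) Ks \<theta> \<and>
            noisy_qfi N D qz (ket N) (M N) Ks \<theta> \<le> C2 * real N powr (2 * b))
       \<and> (\<forall>B. \<forall>\<^sub>F N in sequentially. \<forall>\<theta> A Ks.
            A \<subseteq> {..<N} \<and> card A = d N \<and> noise_channel_on N D A Ks \<longrightarrow>
            B * real N \<le> noisy_qfi N D qz (ket N) (M N) Ks \<theta>)"
proof -
  have D: "0 < D" using spin(1,2) by (intro Nat.gr0I) auto
  have q: "qz \<in> carrier_mat D D" "qp \<in> carrier_mat D D" "hermitian qz" "qm = mat_adjoint qp"
    using spin(3) by (simp_all add: spin_irrep_def)
  define r where "r = (\<Sum>i<D. \<Sum>j<D. cmod (qp $$ (i, j)))"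
  have r: "cmod (qp $$ (i, j)) \<le> r" if "i < D" "j < D" for i j
  proof -
    have "cmod (qp $$ (i, j)) \<le> (\<Sum>j<D. cmod (qp $$ (i, j)))"
      using that by (intro member_le_sum) auto
    also have "\<dots> \<le> r"
      unfolding r_def using that by (intro member_le_sum[of i]) (auto intro: sum_nonneg)
    finally show ?thesis .
  qed
  have r0: "0 \<le> r" by (simp add: r_def sum_nonneg)
  obtain cJ where cJ: "0 < cJ" "\<forall>\<^sub>F N in sequentially. cJ * norm (real N powr a) \<le> norm (J N)"
    using landau_omega.bigE[OF bigthetaD2[OF J(2)]] by blast
  obtain c1 where c1: "0 < c1" "\<forall>\<^sub>F N in sequentially. c1 * norm (real N powr b) \<le> norm (M N)"
    using landau_omega.bigE[OF bigthetaD2[OF M(2)]] by blast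
  obtain c2 where c2: "0 < c2" "\<forall>\<^sub>F N in sequentially. norm (M N) \<le> c2 * norm (real N powr b)"
    using landau_o.bigE[OF bigthetaD1[OF M(2)]] by blast
  \<comment> \<open>The sum of the constants in the two requirements 3 M <= J and 64 Q M <= J, so
    that one comparison of J with \<open>k\<close> times log N * N^b gives both. Eventually
    \<open>c + 1\<close> bounds d / log N and \<open>c2\<close> bounds M / N^b.\<close>
  define k where "k = 3 * c2 + 64 * ((c + 1) * (real D * r) * c2)"
  have k0: "0 < k" unfolding k_def using c2(1) c(1) r0 by (intro add_pos_nonneg) auto
  have "\<forall>\<^sub>F N in sequentially. log 2 (real N) * real N powr (b - a) < cJ / k"
    using log_times_powr_tendsto_0[OF exponents(2)] k0 cJ(1) by (intro order_tendstoD(2)) auto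
  moreover have "\<forall>\<^sub>F N in sequentially. real (d N) / log 2 (real N) < c + 1"
    using d by (rule order_tendstoD(2)) simp
  \<comment> \<open>The eventual conditions see \<open>A\<close> only through its cardinality and
    involve neither \<theta> nor \<open>Ks\<close>, so one threshold for \<open>N\<close> serves all
    of them.\<close>
  ultimately have bounds: "\<forall>\<^sub>F N in sequentially. \<forall>\<theta> A Ks.
      A \<subseteq> {..<N} \<and> card A = d N \<and> noise_channel_on N D A Ks \<longrightarrow>
      c1\<^sup>2 / 25 * real N powr (2 * b) \<le> noisy_qfi N D qz (ket N) (M N) Ks \<theta> \<and>
      noisy_qfi N D qz (ket N) (M N) Ks \<theta> \<le> 8 * c2\<^sup>2 * real N powr (2 * b)"
    using multiplet M(1) cJ(2) c1(2) c2(2) eventually_ge_at_top[of 2]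
  proof eventually_elim
    case (elim N)
    let ?l = "log 2 (real N)"
    have l: "1 \<le> ?l" using elim(8) by (simp add: le_log_iff)
    have J2: "2 * J N \<in> \<nat>" using elim(3) by (simp add: spin_multiplet_def)
    then have "0 \<le> 2 * J N" by (auto elim: Nats_cases)
    then have Jge: "cJ * real N powr a \<le> J N" using elim(5) by simp
    have Mb: "0 < M N" "M N \<in> magnetic_numbers (J N)" "c1 * real N powr b \<le> M N" "M N \<le> c2 * real N powr b"
      using elim(4,6,7) by simp_all
    have dN: "real (d N) \<le> (c + 1) * ?l" using elim(2) l by (simp add: field_simps)
    have kJ: "k * (?l * real N powr b) \<le> J N"
    proof -
      have "?l * real N powr b = (?l * real N powr (b - a)) * real N powr a"
        by (simp add: powr_add[symmetric])
      also have "\<dots> \<le> cJ / k * real N powr a"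
        using elim(1) by (intro mult_right_mono) simp_all
      finally have "k * (?l * real N powr b) \<le> k * (cJ / k * real N powr a)"
        using k0 by (intro mult_left_mono) simp_all
      also have "\<dots> = cJ * real N powr a" using k0 by simp
      finally show ?thesis using Jge by linarith
    qed
    define Q where "Q = real (d N) * (real D * r)"
    have Q0: "0 \<le> Q" using r0 by (simp add: Q_def)
    have MQ: "3 * M N \<le> 3 * c2 * (?l * real N powr b)"
      "64 * (Q * M N) \<le> 64 * ((c + 1) * (real D * r) * c2) * (?l * real N powr b)"
    proof -
      have "real N powr b \<le> ?l * real N powr b" using l by (simp add: mult_le_cancel_right1)
      then have "c2 * real N powr b \<le> c2 * (?l * real N powr b)" using c2(1) by (intro mult_left_mono) auto
      then show "3 * M N \<le> 3 * c2 * (?l * real N powr b)" using Mb(4) by simp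
      have "Q * M N \<le> ((c + 1) * ?l * (real D * r)) * (c2 * real N powr b)"
        unfolding Q_def using dN r0 c(1) l Mb by (intro mult_mono) auto
      then have "64 * (Q * M N) \<le> 64 * (((c + 1) * ?l * (real D * r)) * (c2 * real N powr b))"
        by simp
      also have "\<dots> = 64 * ((c + 1) * (real D * r) * c2) * (?l * real N powr b)"
        by (simp only: mult_ac)
      finally show "64 * (Q * M N) \<le> 64 * ((c + 1) * (real D * r) * c2) * (?l * real N powr b)" .
    qed
    have nn: "0 \<le> 3 * c2 * (?l * real N powr b)"
      "0 \<le> 64 * ((c + 1) * (real D * r) * c2) * (?l * real N powr b)"
      using c2(1) l c(1) r0 by (auto intro!: mult_nonneg_nonneg)
    have MJ: "3 * M N \<le> J N" and QJ: "64 * (Q * M N) \<le> J N"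
      using MQ nn kJ unfolding k_def distrib_right by linarith+
    obtain K :: nat where K: "real K = 2 * M N"
      using magnetic_number_twice_Nats[OF J2 Mb(2)] Mb(1) by auto
    have small: "(1 + Q / lower_coeff (J N) (M N)) ^ K - 1 \<le> 1/8"
      by (rule ladder_error_small[OF Mb(1) MJ K Q0 QJ])
    have sq: "(x * real N powr b)\<^sup>2 = x\<^sup>2 * real N powr (2 * b)" for x
      by (simp add: power_mult_distrib power2_eq_square powr_add[symmetric])
    have M2: "c1\<^sup>2 * real N powr (2 * b) \<le> (M N)\<^sup>2" "(M N)\<^sup>2 \<le> c2\<^sup>2 * real N powr (2 * b)"
      unfolding sq[symmetric] using Mb c1(1) by (auto intro!: power_mono)
    show ?case
    proof (intro allI impI)
      fix \<theta> A Ks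
      assume A: "A \<subseteq> {..<N} \<and> card A = d N \<and> noise_channel_on N D A Ks"
      have "(M N)\<^sup>2 / 25 \<le> noisy_qfi N D qz (ket N) (M N) Ks \<theta>"
        "noisy_qfi N D qz (ket N) (M N) Ks \<theta> \<le> 8 * (M N)\<^sup>2"
        using noisy_qfi_bounds[OF D q r elim(3) Mb(1,2) MJ K, of A Ks \<theta>] A small
        by (simp_all add: Q_def)
      with M2 show "c1\<^sup>2 / 25 * real N powr (2 * b) \<le> noisy_qfi N D qz (ket N) (M N) Ks \<theta> \<and>
          noisy_qfi N D qz (ket N) (M N) Ks \<theta> \<le> 8 * c2\<^sup>2 * real N powr (2 * b)"
        by linarith
    qed
  qed
  have C: "0 < c1\<^sup>2 / 25" "0 < 8 * c2\<^sup>2" using c1(1) c2(1) by simp_all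
  \<comment> \<open>This is where b > 1/2 enters: the surplus exponent 2 b - 1 is positive.\<close>
  have superlinear: "\<forall>\<^sub>F N in sequentially. B * real N \<le> c1\<^sup>2 / 25 * real N powr (2 * b)" for B
  proof -
    have "filterlim (\<lambda>N. real N powr (2 * b - 1)) at_top sequentially"
      using exponents(1) by real_asymp
    then have "\<forall>\<^sub>F N in sequentially. B / (c1\<^sup>2 / 25) \<le> real N powr (2 * b - 1)"
      by (simp only: filterlim_at_top)
    then show ?thesis
      using eventually_gt_at_top[of 0]
    proof eventually_elim
      case (elim N)
      have "B * real N \<le> (c1\<^sup>2 / 25 * real N powr (2 * b - 1)) * real N"
        using elim C(1) by (intro mult_right_mono) (simp_all add: field_simps)
      also have "\<dots> = c1\<^sup>2 / 25 * real N powr (2 * b)"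
        using elim(2) by (simp add: powr_diff)
      finally show ?case .
    qed
  qed
  show ?thesis
  proof (intro conjI allI)
    show "\<exists>C1>0. \<exists>C2>0. \<forall>\<^sub>F N in sequentially. \<forall>\<theta> A Ks.
            A \<subseteq> {..<N} \<and> card A = d N \<and> noise_channel_on N D A Ks \<longrightarrow>
            C1 * real N powr (2 * b) \<le> noisy_qfi N D qz (ket N) (M N) Ks \<theta> \<and>
            noisy_qfi N D qz (ket N) (M N) Ks \<theta> \<le> C2 * real N powr (2 * b)"
      using C bounds by blast
    fix B
    show "\<forall>\<^sub>F N in sequentially. \<forall>\<theta> A Ks.
            A \<subseteq> {..<N} \<and> card A = d N \<and> noise_channel_on N D A Ks \<longrightarrow>
            B * real N \<le> noisy_qfi N D qz (ket N) (M N) Ks \<theta>"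
      using bounds superlinear[of B] by eventually_elim (meson order_trans)
  qed
qed

end
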